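(* Let $R$ be a unital ring and let $M$ be a Krull-Schmidt artinian left $R$-module. Then the following conditions are equivalent: 1. $M$ satisfies the $AKS_1$ condition. 2. $M$ satisfies the $AKS_2$ condition. 3. $M$ satisfies the $AKS_3$ condition.
   Context: $M$ is Krull-Schmidt artinian if its set $\mathcal{S}(M)$ of direct summands, ordered by inclusion, satisfies the descending chain condition (equivalently, the ascending chain condition). A direct sum decomposition of $M$ is an internal decomposition $M=\bigoplus_{\alpha\in A}M_\alpha$ with all $M_\alpha$ nonzero; it is indecomposable if every $M_\alpha$ is indecomposable. Two decompositions $M=\bigoplus_{\alpha\in A}M_\alpha$ and $M=\bigoplus_{\beta\in B}N_\beta$ are decomposition-isomorphic if there is a bijection $\phi:A\to B$ such that $M_\alpha\cong N_{\phi(\alpha)}$ for every $\alpha\in A$. $M$ satisfies $AKS_1$ if it admits only finitely many direct sum decompositions up to decomposition-isomorphisms; $AKS_2$ if it has only finitely many indecomposable direct sum decompositions up to decomposition-isomorphisms; $AKS_3$ if it has only finitely many direct summands up to isomorphism. *)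

theory Defs
  imports "HOL-Algebra.Algebra"
begin

text \<open>The locale \<^locale>\<open>module\<close> of HOL-Algebra assumes a commutative ring of scalars. The following
  is the same notion over an arbitrary unital ring. The multiplication and unit
  fields that the record of \<open>M\<close> inherits from rings play no role.\<close>

locale left_module = R?: ring R + M?: abelian_group M
  for R :: "('a, 'r) ring_scheme" (structure) and M :: "('a, 'b, 'm) module_scheme" (structure) +
  assumes smult_closed [simp, intro]:
      "\<lbrakk>a \<in> carrier R; x \<in> carrier M\<rbrakk> \<Longrightarrow> a \<odot>\<^bsub>M\<^esub> x \<in> carrier M"
    and smult_l_distr:
      "\<lbrakk>a \<in> carrier R; b \<in> carrier R; x \<in> carrier M\<rbrakk>
        \<Longrightarrow> (a \<oplus>\<^bsub>R\<^esub> b) \<odot>\<^bsub>M\<^esub> x = a \<odot>\<^bsub>M\<^esub> x \<oplus>\<^bsub>M\<^esub> b \<odot>\<^bsub>M\<^esub> x"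
    and smult_r_distr:
      "\<lbrakk>a \<in> carrier R; x \<in> carrier M; y \<in> carrier M\<rbrakk>
        \<Longrightarrow> a \<odot>\<^bsub>M\<^esub> (x \<oplus>\<^bsub>M\<^esub> y) = a \<odot>\<^bsub>M\<^esub> x \<oplus>\<^bsub>M\<^esub> a \<odot>\<^bsub>M\<^esub> y"
    and smult_assoc1:
      "\<lbrakk>a \<in> carrier R; b \<in> carrier R; x \<in> carrier M\<rbrakk>
        \<Longrightarrow> (a \<otimes>\<^bsub>R\<^esub> b) \<odot>\<^bsub>M\<^esub> x = a \<odot>\<^bsub>M\<^esub> (b \<odot>\<^bsub>M\<^esub> x)"
    and smult_one [simp]:
      "x \<in> carrier M \<Longrightarrow> \<one>\<^bsub>R\<^esub> \<odot>\<^bsub>M\<^esub> x = x"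

definition module_isomorphic ::
    "('a, 'r) ring_scheme \<Rightarrow> ('a, 'b, 'm) module_scheme \<Rightarrow> ('a, 'c, 'n) module_scheme \<Rightarrow> bool" where
  "module_isomorphic R M N \<longleftrightarrow>
    (\<exists>f \<in> iso (add_monoid M) (add_monoid N).
      \<forall>a \<in> carrier R. \<forall>x \<in> carrier M. f (a \<odot>\<^bsub>M\<^esub> x) = a \<odot>\<^bsub>N\<^esub> f x)"

abbreviation submodule_isomorphic ::
    "('a, 'r) ring_scheme \<Rightarrow> ('a, 'b, 'm) module_scheme \<Rightarrow> 'b set \<Rightarrow> 'b set \<Rightarrow> bool" where
  "submodule_isomorphic R M K L \<equiv> module_isomorphic R (M\<lparr>carrier := K\<rparr>) (M\<lparr>carrier := L\<rparr>)"

definition complementary ::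
    "('a, 'r) ring_scheme \<Rightarrow> ('a, 'b, 'm) module_scheme \<Rightarrow> 'b set \<Rightarrow> 'b set \<Rightarrow> bool" where
  "complementary R M K L \<longleftrightarrow>
    submodule K R M \<and> submodule L R M \<and> K \<inter> L = {\<zero>\<^bsub>M\<^esub>} \<and> K <+>\<^bsub>M\<^esub> L = carrier M"

definition direct_summands ::
    "('a, 'r) ring_scheme \<Rightarrow> ('a, 'b, 'm) module_scheme \<Rightarrow> 'b set set" where
  "direct_summands R M = {K. \<exists>L. complementary R M K L}"

definition krull_schmidt_artinian ::
    "('a, 'r) ring_scheme \<Rightarrow> ('a, 'b, 'm) module_scheme \<Rightarrow> bool" where
  "krull_schmidt_artinian R M \<longleftrightarrow>
    \<not> (\<exists>S :: nat \<Rightarrow> 'b set. \<forall>n. S n \<in> direct_summands R M \<and> S (Suc n) \<subset> S n)"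

definition indecomposable ::
    "('a, 'r) ring_scheme \<Rightarrow> ('a, 'b, 'm) module_scheme \<Rightarrow> bool" where
  "indecomposable R M \<longleftrightarrow>
    carrier M \<noteq> {\<zero>\<^bsub>M\<^esub>} \<and>
    (\<forall>K L. complementary R M K L \<longrightarrow> K = {\<zero>\<^bsub>M\<^esub>} \<or> L = {\<zero>\<^bsub>M\<^esub>})"

definition external_direct_sum ::
    "('a, 'b, 'm) module_scheme \<Rightarrow> 'i set \<Rightarrow> ('i \<Rightarrow> 'b set) \<Rightarrow> ('i \<Rightarrow> 'b) set" where
  "external_direct_sum M A N = {x \<in> (\<Pi>\<^sub>E \<alpha>\<in>A. N \<alpha>). finite {\<alpha> \<in> A. x \<alpha> \<noteq> \<zero>\<^bsub>M\<^esub>}}"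

definition direct_sum_map ::
    "('a, 'b, 'm) module_scheme \<Rightarrow> 'i set \<Rightarrow> ('i \<Rightarrow> 'b) \<Rightarrow> 'b" where
  "direct_sum_map M A x = finsum M x {\<alpha> \<in> A. x \<alpha> \<noteq> \<zero>\<^bsub>M\<^esub>}"

text \<open>A module is the internal direct sum of a (possibly infinite, possibly empty) family of
  submodules if the canonical map from the external direct sum is a bijection.\<close>

definition direct_sum_decomposition ::
    "('a, 'r) ring_scheme \<Rightarrow> ('a, 'b, 'm) module_scheme \<Rightarrow> 'i set \<Rightarrow> ('i \<Rightarrow> 'b set) \<Rightarrow> bool" where
  "direct_sum_decomposition R M A N \<longleftrightarrow>
    (\<forall>\<alpha>\<in>A. submodule (N \<alpha>) R M \<and> N \<alpha> \<noteq> {\<zero>\<^bsub>M\<^esub>}) \<and>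
    bij_betw (direct_sum_map M A) (external_direct_sum M A N) (carrier M)"

definition indecomposable_decomposition ::
    "('a, 'r) ring_scheme \<Rightarrow> ('a, 'b, 'm) module_scheme \<Rightarrow> 'i set \<Rightarrow> ('i \<Rightarrow> 'b set) \<Rightarrow> bool" where
  "indecomposable_decomposition R M A N \<longleftrightarrow>
    direct_sum_decomposition R M A N \<and> (\<forall>\<alpha>\<in>A. indecomposable R (M\<lparr>carrier := N \<alpha>\<rparr>))"

definition decomposition_isomorphic ::
    "('a, 'r) ring_scheme \<Rightarrow> ('a, 'b, 'm) module_scheme \<Rightarrow>
      'i set \<Rightarrow> ('i \<Rightarrow> 'b set) \<Rightarrow> 'j set \<Rightarrow> ('j \<Rightarrow> 'b set) \<Rightarrow> bool" where
  "decomposition_isomorphic R M A N B P \<longleftrightarrow>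
    (\<exists>\<phi>. bij_betw \<phi> A B \<and> (\<forall>\<alpha>\<in>A. submodule_isomorphic R M (N \<alpha>) (P (\<phi> \<alpha>))))"

text \<open>To collect all decompositions in one set, a type of indices has to be fixed. The type
  \<^typ>\<open>'b set\<close> of subsets of \<open>M\<close> is large enough: the components of a decomposition are pairwise
  distinct, so every decomposition, over whatever index type, can be indexed by its own
  components; see the lemma \<open>decomposition_self_indexed\<close> below.\<close>

definition decompositions ::
    "('a, 'r) ring_scheme \<Rightarrow> ('a, 'b, 'm) module_scheme \<Rightarrow> ('b set set \<times> ('b set \<Rightarrow> 'b set)) set" where
  "decompositions R M = {(A, N). direct_sum_decomposition R M A N}"

definition indecomposable_decompositions ::
    "('a, 'r) ring_scheme \<Rightarrow> ('a, 'b, 'm) module_scheme \<Rightarrow> ('b set set \<times> ('b set \<Rightarrow> 'b set)) set" where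
  "indecomposable_decompositions R M = {(A, N). indecomposable_decomposition R M A N}"

definition finite_up_to :: "('c \<Rightarrow> 'c \<Rightarrow> bool) \<Rightarrow> 'c set \<Rightarrow> bool" where
  "finite_up_to r C \<longleftrightarrow> finite (C // {(x, y). x \<in> C \<and> y \<in> C \<and> r x y})"

definition AKS1 :: "('a, 'r) ring_scheme \<Rightarrow> ('a, 'b, 'm) module_scheme \<Rightarrow> bool" where
  "AKS1 R M \<longleftrightarrow>
    finite_up_to (\<lambda>(A, N) (B, P). decomposition_isomorphic R M A N B P) (decompositions R M)"

definition AKS2 :: "('a, 'r) ring_scheme \<Rightarrow> ('a, 'b, 'm) module_scheme \<Rightarrow> bool" where
  "AKS2 R M \<longleftrightarrow>
    finite_up_to (\<lambda>(A, N) (B, P). decomposition_isomorphic R M A N B P)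
      (indecomposable_decompositions R M)"

definition AKS3 :: "('a, 'r) ring_scheme \<Rightarrow> ('a, 'b, 'm) module_scheme \<Rightarrow> bool" where
  "AKS3 R M \<longleftrightarrow> finite_up_to (submodule_isomorphic R M) (direct_summands R M)"

lemma module_isomorphic_refl: "module_isomorphic R M M"
  unfolding module_isomorphic_def
  by (rule bexI[of _ "\<lambda>x. x"]) (auto simp: iso_def hom_def bij_betw_def)

context left_module
begin

lemma decomposition_inj:
  assumes "direct_sum_decomposition R M A N"
  shows "inj_on N A"
proof (rule inj_onI, rule ccontr)
  fix \<alpha> \<beta> assume ab: "\<alpha> \<in> A" "\<beta> \<in> A" "N \<alpha> = N \<beta>" "\<alpha> \<noteq> \<beta>"
  have sub: "submodule (N \<gamma>) R M" "N \<gamma> \<noteq> {\<zero>\<^bsub>M\<^esub>}" if "\<gamma> \<in> A" for \<gamma>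
    using assms that by (auto simp: direct_sum_decomposition_def)
  have z: "\<zero>\<^bsub>M\<^esub> \<in> N \<gamma>" "N \<gamma> \<subseteq> carrier M" if "\<gamma> \<in> A" for \<gamma>
    using subgroup.one_closed[OF submodule.axioms(1)[OF sub(1)[OF that]]]
      subgroup.subset[OF submodule.axioms(1)[OF sub(1)[OF that]]] by auto
  obtain x where x: "x \<in> N \<alpha>" "x \<noteq> \<zero>\<^bsub>M\<^esub>" using sub(2) z(1) ab by blast
  define s where "s = (\<lambda>\<gamma>. \<lambda>\<delta>\<in>A. if \<delta> = \<gamma> then x else \<zero>\<^bsub>M\<^esub>)"
  have supp: "{\<delta> \<in> A. s \<gamma> \<delta> \<noteq> \<zero>\<^bsub>M\<^esub>} = {\<gamma>}" if "\<gamma> \<in> A" for \<gamma>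
    using that x by (auto simp: s_def)
  have mem: "s \<gamma> \<in> external_direct_sum M A N" if "\<gamma> \<in> A" "x \<in> N \<gamma>" for \<gamma>
    using that z(1) supp[OF that(1)] by (auto simp: external_direct_sum_def s_def PiE_def)
  have val: "direct_sum_map M A (s \<gamma>) = x" if "\<gamma> \<in> A" for \<gamma>
  proof -
    have "x \<in> carrier M" using x z(2) ab by blast
    moreover have "s \<gamma> \<gamma> = x" using that by (simp add: s_def)
    ultimately show ?thesis
      using finsum_insert[of "{}" \<gamma> "s \<gamma>"] by (simp add: direct_sum_map_def supp[OF that])
  qed
  have "s \<alpha> = s \<beta>"
    using assms mem[of \<alpha>] mem[of \<beta>] val[of \<alpha>] val[of \<beta>] ab x
    by (auto simp: direct_sum_decomposition_def bij_betw_def dest!: inj_onD)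
  then have "s \<alpha> \<alpha> = s \<beta> \<alpha>" by simp
  then show False using ab x by (simp add: s_def)
qed

lemma decomposition_self_indexed:
  assumes "direct_sum_decomposition R M A N"
  shows "direct_sum_decomposition R M (N ` A) (\<lambda>K. K)"
    and "decomposition_isomorphic R M A N (N ` A) (\<lambda>K. K)"
proof -
  have inj: "inj_on N A" using decomposition_inj[OF assms] .
  show "decomposition_isomorphic R M A N (N ` A) (\<lambda>K. K)"
    using inj by (auto simp: decomposition_isomorphic_def bij_betw_def module_isomorphic_refl
        intro!: exI[of _ N])
  let ?c = "\<lambda>x. \<lambda>\<alpha>\<in>A. x (N \<alpha>)"
  let ?d = "\<lambda>y. \<lambda>K\<in>N ` A. y (the_inv_into A N K)"
  have inv: "the_inv_into A N (N \<alpha>) = \<alpha>" if "\<alpha> \<in> A" for \<alpha>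
    using that inj by (simp add: the_inv_into_f_f)
  have suppc: "{K \<in> N ` A. x K \<noteq> \<zero>\<^bsub>M\<^esub>} = N ` {\<alpha> \<in> A. ?c x \<alpha> \<noteq> \<zero>\<^bsub>M\<^esub>}" for x
    by auto
  have suppd: "{K \<in> N ` A. ?d y K \<noteq> \<zero>\<^bsub>M\<^esub>} = N ` {\<alpha> \<in> A. y \<alpha> \<noteq> \<zero>\<^bsub>M\<^esub>}" for y
    using inv by auto
  have "bij_betw ?c (external_direct_sum M (N ` A) (\<lambda>K. K)) (external_direct_sum M A N)"
  proof (rule bij_betw_byWitness[where f' = ?d])
    show "\<forall>x\<in>external_direct_sum M (N ` A) (\<lambda>K. K). ?d (?c x) = x"
      using inv by (fastforce simp: external_direct_sum_def PiE_def extensional_def restrict_def)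
    show "\<forall>y\<in>external_direct_sum M A N. ?c (?d y) = y"
      using inv by (fastforce simp: external_direct_sum_def PiE_def extensional_def restrict_def)
    show "?c ` external_direct_sum M (N ` A) (\<lambda>K. K) \<subseteq> external_direct_sum M A N"
    proof (rule image_subsetI)
      fix x assume "x \<in> external_direct_sum M (N ` A) (\<lambda>K. K)"
      then have x: "x \<in> (\<Pi>\<^sub>E K\<in>N ` A. K)" "finite {K \<in> N ` A. x K \<noteq> \<zero>\<^bsub>M\<^esub>}"
        by (auto simp: external_direct_sum_def)
      have "finite {\<alpha> \<in> A. ?c x \<alpha> \<noteq> \<zero>\<^bsub>M\<^esub>}"
        using x(2) unfolding suppc
        by (rule finite_imageD) (rule inj_on_subset[OF inj], auto)
      with x(1) show "?c x \<in> external_direct_sum M A N"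
        by (auto simp: external_direct_sum_def)
    qed
    show "?d ` external_direct_sum M A N \<subseteq> external_direct_sum M (N ` A) (\<lambda>K. K)"
    proof (rule image_subsetI)
      fix y assume "y \<in> external_direct_sum M A N"
      then have y: "y \<in> (\<Pi>\<^sub>E \<alpha>\<in>A. N \<alpha>)" "finite {\<alpha> \<in> A. y \<alpha> \<noteq> \<zero>\<^bsub>M\<^esub>}"
        by (auto simp: external_direct_sum_def)
      have "finite {K \<in> N ` A. ?d y K \<noteq> \<zero>\<^bsub>M\<^esub>}"
        unfolding suppd using y(2) by (rule finite_imageI)
      with y(1) inv show "?d y \<in> external_direct_sum M (N ` A) (\<lambda>K. K)"
        by (auto simp: external_direct_sum_def)
    qed
  qed
  moreover have "bij_betw (direct_sum_map M A) (external_direct_sum M A N) (carrier M)"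
    using assms by (simp add: direct_sum_decomposition_def)
  ultimately have b: "bij_betw (direct_sum_map M A \<circ> ?c)
      (external_direct_sum M (N ` A) (\<lambda>K. K)) (carrier M)"
    by (rule bij_betw_trans)
  have eq: "(direct_sum_map M A \<circ> ?c) x = direct_sum_map M (N ` A) x"
    if x: "x \<in> external_direct_sum M (N ` A) (\<lambda>K. K)" for x
  proof -
    have carr: "x (N \<alpha>) \<in> carrier M" if a: "\<alpha> \<in> A" for \<alpha>
    proof -
      have "submodule (N \<alpha>) R M" using assms a by (auto simp: direct_sum_decomposition_def)
      then have "N \<alpha> \<subseteq> carrier M"
        using subgroup.subset[OF submodule.axioms(1)] by force
      moreover have "x (N \<alpha>) \<in> N \<alpha>"
        using x a by (auto simp: external_direct_sum_def)
      ultimately show ?thesis by blast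
    qed
    let ?S = "{\<alpha> \<in> A. ?c x \<alpha> \<noteq> \<zero>\<^bsub>M\<^esub>}"
    have "finsum M x (N ` ?S) = finsum M (\<lambda>\<alpha>. x (N \<alpha>)) ?S"
      by (rule add.finprod_reindex) (use carr in auto, rule inj_on_subset[OF inj], auto)
    also have "\<dots> = finsum M (?c x) ?S"
      by (rule finsum_cong') (simp_all add: carr Pi_def)
    finally show ?thesis 
      unfolding direct_sum_map_def suppc[of x] o_apply by (rule sym)
  qed
  have "bij_betw (direct_sum_map M (N ` A)) (external_direct_sum M (N ` A) (\<lambda>K. K)) (carrier M)"
    by (rule bij_betw_cong[THEN iffD1, OF _ b]) (rule eq)
  then show "direct_sum_decomposition R M (N ` A) (\<lambda>K. K)"
    using assms by (auto simp: direct_sum_decomposition_def)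
qed

end

end

theory Submission
  imports Defs
begin

text \<open>
  The three conditions are compared through partial sums of a decomposition: if
  \<open>M = \<Oplus>\<^sub>\<alpha>\<^sub>\<in>\<^sub>A N\<^sub>\<alpha>\<close> and \<open>B \<subseteq> A\<close>, then \<open>\<Oplus>\<^sub>\<alpha>\<^sub>\<in>\<^sub>B N\<^sub>\<alpha>\<close> is a direct summand of \<open>M\<close>, it grows
  strictly with \<open>B\<close>, and its isomorphism type depends only on those of the \<open>N\<^sub>\<alpha>\<close>. In particular,
  under the chain condition every decomposition is finite.

  \<^noindent> That AKS1 implies AKS2 is clear, since indecomposable decompositions are decompositions.

  \<^noindent> Assume AKS2. By well-founded induction over the summands, each summand has an
  indecomposable decomposition (\<open>indecomposable_decomposition_exists\<close>). Applied to a summand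
  and to a complement of it, this exhibits the summand as a partial sum of an indecomposable
  decomposition of \<open>M\<close>. There are finitely many of these up to isomorphism, and each is finite and so
  has finitely many partial sums; hence AKS3.

  \<^noindent> Assume AKS3, with \<open>n\<close> isomorphism classes of summands. A summand is never isomorphic to a
  summand strictly inside it, since iterating the isomorphism would produce an infinite descending
  chain (\<open>summand_not_isomorphic_psubset\<close>). Hence chains of summands have at most \<open>n\<close> members.
  Removing the components of a decomposition one by one leaves a chain of partial sums that is
  longer than the number of components, so that this number is bounded
  (\<open>card_index_bounded\<close>). A decomposition is determined up to isomorphism by the sequence of classes
  of its components, and there are finitely many sequences of bounded length over \<open>n\<close> classes; hence
  AKS1.
\<close>

section \<open>Submodules and linear isomorphisms\<close>

text \<open>A map of the ambient type that is an isomorphism between two subsets of \<open>M\<close>. Unlike an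
  isomorphism of the modules with replaced carriers, it can be restricted and iterated freely.\<close>

definition linear_iso ::
    "('a, 'r) ring_scheme \<Rightarrow> ('a, 'b, 'm) module_scheme \<Rightarrow> ('b \<Rightarrow> 'b) \<Rightarrow> 'b set \<Rightarrow> 'b set \<Rightarrow> bool" where
  "linear_iso R M f K L \<longleftrightarrow> bij_betw f K L \<and>
    (\<forall>x\<in>K. \<forall>y\<in>K. f (x \<oplus>\<^bsub>M\<^esub> y) = f x \<oplus>\<^bsub>M\<^esub> f y) \<and>
    (\<forall>a\<in>carrier R. \<forall>x\<in>K. f (a \<odot>\<^bsub>M\<^esub> x) = a \<odot>\<^bsub>M\<^esub> f x)"

lemma submodule_isomorphic_iff_linear_iso:
  "submodule_isomorphic R M K L \<longleftrightarrow> (\<exists>f. linear_iso R M f K L)"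
  by (auto simp: module_isomorphic_def linear_iso_def iso_def hom_def bij_betw_def Bex_def)

lemma linear_iso_comp:
  assumes "linear_iso R M f J K" "linear_iso R M g K L"
  shows "linear_iso R M (g \<circ> f) J L"
  using assms bij_betw_trans[of f J K g L] bij_betwE[of f J K]
  by (auto simp: linear_iso_def)

lemma submodule_isomorphic_trans:
  assumes "submodule_isomorphic R M J K" "submodule_isomorphic R M K L"
  shows "submodule_isomorphic R M J L"
  using assms linear_iso_comp unfolding submodule_isomorphic_iff_linear_iso by blast

text \<open>\<open>W\<close> is the internal direct sum of \<open>K\<close> and \<open>L\<close>. Keeping \<open>W\<close> as a subset of \<open>M\<close>, instead of
  changing the carrier, lets sums inside different summands be compared and combined.\<close>

definition binary_sum ::
    "('a, 'r) ring_scheme \<Rightarrow> ('a, 'b, 'm) module_scheme \<Rightarrow> 'b set \<Rightarrow> 'b set \<Rightarrow> 'b set \<Rightarrow> bool" where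
  "binary_sum R M K L W \<longleftrightarrow>
    submodule K R M \<and> submodule L R M \<and> K \<inter> L = {\<zero>\<^bsub>M\<^esub>} \<and> K <+>\<^bsub>M\<^esub> L = W"

context left_module
begin

lemma smult_l_zero:
  assumes "x \<in> carrier M"
  shows "\<zero> \<odot>\<^bsub>M\<^esub> x = \<zero>\<^bsub>M\<^esub>"
proof -
  have "\<zero> \<odot>\<^bsub>M\<^esub> x \<oplus>\<^bsub>M\<^esub> \<zero> \<odot>\<^bsub>M\<^esub> x = \<zero> \<odot>\<^bsub>M\<^esub> x \<oplus>\<^bsub>M\<^esub> \<zero>\<^bsub>M\<^esub>"
    using smult_l_distr[of \<zero> \<zero> x] assms by simp
  then show ?thesis using assms by (simp del: M.r_zero)
qed

lemma smult_r_zero: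
  assumes "a \<in> carrier R"
  shows "a \<odot>\<^bsub>M\<^esub> \<zero>\<^bsub>M\<^esub> = \<zero>\<^bsub>M\<^esub>"
proof -
  have "a \<odot>\<^bsub>M\<^esub> \<zero>\<^bsub>M\<^esub> \<oplus>\<^bsub>M\<^esub> a \<odot>\<^bsub>M\<^esub> \<zero>\<^bsub>M\<^esub> = a \<odot>\<^bsub>M\<^esub> \<zero>\<^bsub>M\<^esub> \<oplus>\<^bsub>M\<^esub> \<zero>\<^bsub>M\<^esub>"
    using smult_r_distr[of a "\<zero>\<^bsub>M\<^esub>" "\<zero>\<^bsub>M\<^esub>"] assms by simp
  then show ?thesis using assms by (simp del: M.r_zero)
qed

text \<open>With a unit in the ring, closure under scalars gives closure under negatives. Submodules are
  thereby described without inverses, whose definition would depend on the carrier.\<close>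

lemma minus_eq_smult:
  assumes "x \<in> carrier M"
  shows "\<ominus>\<^bsub>M\<^esub> x = (\<ominus> \<one>) \<odot>\<^bsub>M\<^esub> x"
proof -
  have "(\<ominus> \<one>) \<odot>\<^bsub>M\<^esub> x \<oplus>\<^bsub>M\<^esub> x = \<zero>\<^bsub>M\<^esub>"
    using smult_l_distr[of "\<ominus> \<one>" \<one> x] assms smult_l_zero[of x] by (simp add: R.l_neg)
  then show ?thesis using assms by (intro M.minus_equality) auto
qed

lemma submodule_iff:
  "submodule H R M \<longleftrightarrow> H \<subseteq> carrier M \<and> \<zero>\<^bsub>M\<^esub> \<in> H \<and> (\<forall>x\<in>H. \<forall>y\<in>H. x \<oplus>\<^bsub>M\<^esub> y \<in> H) \<and>
    (\<forall>a\<in>carrier R. \<forall>x\<in>H. a \<odot>\<^bsub>M\<^esub> x \<in> H)" (is "_ \<longleftrightarrow> ?r")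
proof
  assume "submodule H R M"
  then interpret submodule H R M .
  show ?r using subset m_closed one_closed by auto
next
  assume r: ?r
  have "inv\<^bsub>add_monoid M\<^esub> x \<in> H" if "x \<in> H" for x
    using r minus_eq_smult[of x] that by (auto simp: a_inv_def[symmetric] subset_iff)
  with r show "submodule H R M"
    by (auto intro!: submodule.intro subgroup.intro submodule_axioms.intro)
qed

lemma submodule_minus: "submodule H R M \<Longrightarrow> x \<in> H \<Longrightarrow> \<ominus>\<^bsub>M\<^esub> x \<in> H"
  using minus_eq_smult[of x] by (auto simp: submodule_iff)

text \<open>This transports the description of submodules to a submodule as ambient module, where
  indecomposability looks for complements.\<close>

lemma left_module_submodule:
  assumes "submodule H R M"
  shows "left_module R (M\<lparr>carrier := H\<rparr>)"
proof -
  have H: "H \<subseteq> carrier M" "\<zero>\<^bsub>M\<^esub> \<in> H" "\<And>x y. x \<in> H \<Longrightarrow> y \<in> H \<Longrightarrow> x \<oplus>\<^bsub>M\<^esub> y \<in> H"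
    "\<And>a x. a \<in> carrier R \<Longrightarrow> x \<in> H \<Longrightarrow> a \<odot>\<^bsub>M\<^esub> x \<in> H"
    using assms by (auto simp: submodule_iff)
  have c: "x \<in> carrier M" if "x \<in> H" for x using that H(1) by blast
  have inv: "\<exists>y\<in>H. y \<oplus>\<^bsub>M\<^esub> x = \<zero>\<^bsub>M\<^esub>" if "x \<in> H" for x
    using submodule_minus[OF assms that] M.l_neg[OF c[OF that]] by blast
  have "abelian_group (M\<lparr>carrier := H\<rparr>)"
    by (rule abelian_groupI) (use inv in \<open>simp_all add: H(2,3) c M.a_ac\<close>)
  then show ?thesis
    by (intro left_module.intro left_module_axioms.intro R.ring_axioms)
      (simp_all add: H(4) c smult_l_distr smult_r_distr smult_assoc1)
qed

lemma submodule_of_submodule_iff: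
  assumes "submodule W R M"
  shows "submodule K R (M\<lparr>carrier := W\<rparr>) \<longleftrightarrow> submodule K R M \<and> K \<subseteq> W"
  using assms by (auto simp: submodule_iff left_module.submodule_iff[OF left_module_submodule[OF assms]])

section \<open>Binary direct sums\<close>

lemma set_add_iff: "x \<in> K <+>\<^bsub>M\<^esub> L \<longleftrightarrow> (\<exists>k\<in>K. \<exists>l\<in>L. x = k \<oplus>\<^bsub>M\<^esub> l)"
  by (auto simp: set_add_def')

lemma submodule_set_add:
  assumes "submodule K R M" "submodule L R M"
  shows "submodule (K <+>\<^bsub>M\<^esub> L) R M"
proof -
  have K: "K \<subseteq> carrier M" "\<zero>\<^bsub>M\<^esub> \<in> K" "\<And>x y. x \<in> K \<Longrightarrow> y \<in> K \<Longrightarrow> x \<oplus>\<^bsub>M\<^esub> y \<in> K"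
    "\<And>a x. a \<in> carrier R \<Longrightarrow> x \<in> K \<Longrightarrow> a \<odot>\<^bsub>M\<^esub> x \<in> K"
    using assms(1) by (auto simp: submodule_iff)
  have L: "L \<subseteq> carrier M" "\<zero>\<^bsub>M\<^esub> \<in> L" "\<And>x y. x \<in> L \<Longrightarrow> y \<in> L \<Longrightarrow> x \<oplus>\<^bsub>M\<^esub> y \<in> L"
    "\<And>a x. a \<in> carrier R \<Longrightarrow> x \<in> L \<Longrightarrow> a \<odot>\<^bsub>M\<^esub> x \<in> L"
    using assms(2) by (auto simp: submodule_iff)
  show ?thesis
    unfolding submodule_iff
  proof (intro conjI ballI)
    show "K <+>\<^bsub>M\<^esub> L \<subseteq> carrier M" using K(1) L(1) by (rule M.set_add_closed)
    show "\<zero>\<^bsub>M\<^esub> \<in> K <+>\<^bsub>M\<^esub> L"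
      unfolding set_add_iff using K(2) L(2) M.l_zero[OF M.zero_closed] by metis
  next
    fix x y assume "x \<in> K <+>\<^bsub>M\<^esub> L" "y \<in> K <+>\<^bsub>M\<^esub> L"
    then obtain k l k' l' where e: "k \<in> K" "l \<in> L" "k' \<in> K" "l' \<in> L"
      "x = k \<oplus>\<^bsub>M\<^esub> l" "y = k' \<oplus>\<^bsub>M\<^esub> l'" by (auto simp: set_add_iff)
    have "k \<in> carrier M" "l \<in> carrier M" "k' \<in> carrier M" "l' \<in> carrier M"
      using e K L by auto
    then have "x \<oplus>\<^bsub>M\<^esub> y = (k \<oplus>\<^bsub>M\<^esub> k') \<oplus>\<^bsub>M\<^esub> (l \<oplus>\<^bsub>M\<^esub> l')"
      using e by (simp add: M.a_ac)
    then show "x \<oplus>\<^bsub>M\<^esub> y \<in> K <+>\<^bsub>M\<^esub> L"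
      using e(1-4) K(3) L(3) unfolding set_add_iff by blast
  next
    fix a x assume a: "a \<in> carrier R" and "x \<in> K <+>\<^bsub>M\<^esub> L"
    then obtain k l where e: "k \<in> K" "l \<in> L" "x = k \<oplus>\<^bsub>M\<^esub> l" by (auto simp: set_add_iff)
    then have "k \<in> carrier M" "l \<in> carrier M" using K(1) L(1) by auto
    then have "a \<odot>\<^bsub>M\<^esub> x = a \<odot>\<^bsub>M\<^esub> k \<oplus>\<^bsub>M\<^esub> a \<odot>\<^bsub>M\<^esub> l"
      using a e by (simp add: smult_r_distr)
    then show "a \<odot>\<^bsub>M\<^esub> x \<in> K <+>\<^bsub>M\<^esub> L" using e(1,2) K(4) L(4) a unfolding set_add_iff by blast
  qed
qed

lemma submodule_Int:
  "submodule K R M \<Longrightarrow> submodule L R M \<Longrightarrow> submodule (K \<inter> L) R M"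
  by (auto simp: submodule_iff)

lemma binary_sum_submodule:
  assumes "binary_sum R M K L W"
  shows "submodule K R M" "submodule L R M" "submodule W R M"
  using assms submodule_set_add by (auto simp: binary_sum_def)

lemma binary_sum_commute:
  assumes "binary_sum R M K L W"
  shows "binary_sum R M L K W"
proof -
  have "K \<subseteq> carrier M" "L \<subseteq> carrier M"
    using assms by (auto simp: binary_sum_def submodule_iff)
  then have "L <+>\<^bsub>M\<^esub> K = K <+>\<^bsub>M\<^esub> L"
    by (auto simp: set_add_iff) (metis M.a_comm subsetD)+
  then show ?thesis using assms by (auto simp: binary_sum_def)
qed

lemma binary_sum_subset:
  assumes "binary_sum R M K L W"
  shows "K \<subseteq> W"
proof
  fix k assume k: "k \<in> K"
  moreover have "K \<subseteq> carrier M" "\<zero>\<^bsub>M\<^esub> \<in> L" using assms by (auto simp: binary_sum_def submodule_iff)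
  ultimately have "k = k \<oplus>\<^bsub>M\<^esub> \<zero>\<^bsub>M\<^esub>" by auto
  then show "k \<in> W" using k \<open>\<zero>\<^bsub>M\<^esub> \<in> L\<close> assms by (force simp: binary_sum_def set_add_iff)
qed

lemma binary_sum_unique:
  assumes "binary_sum R M K L W" "k \<in> K" "k' \<in> K" "l \<in> L" "l' \<in> L"
    "k \<oplus>\<^bsub>M\<^esub> l = k' \<oplus>\<^bsub>M\<^esub> l'"
  shows "k = k'" "l = l'"
proof -
  have s: "submodule K R M" "submodule L R M" and z: "K \<inter> L = {\<zero>\<^bsub>M\<^esub>}"
    using assms by (auto simp: binary_sum_def)
  have c: "k \<in> carrier M" "l \<in> carrier M" "k' \<in> carrier M" "l' \<in> carrier M"
    using s assms(2-5) by (auto simp: submodule_iff)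
  have "\<ominus>\<^bsub>M\<^esub> k' \<oplus>\<^bsub>M\<^esub> k = l' \<oplus>\<^bsub>M\<^esub> \<ominus>\<^bsub>M\<^esub> l"
  proof -
    have "\<ominus>\<^bsub>M\<^esub> k' \<oplus>\<^bsub>M\<^esub> k = \<ominus>\<^bsub>M\<^esub> k' \<oplus>\<^bsub>M\<^esub> (k \<oplus>\<^bsub>M\<^esub> l) \<oplus>\<^bsub>M\<^esub> \<ominus>\<^bsub>M\<^esub> l"
      using c by (simp add: M.a_assoc M.r_neg)
    also have "\<dots> = l' \<oplus>\<^bsub>M\<^esub> \<ominus>\<^bsub>M\<^esub> l"
      unfolding assms(6) using c by (simp add: M.a_assoc[symmetric] M.l_neg)
    finally show ?thesis .
  qed
  moreover have "\<ominus>\<^bsub>M\<^esub> k' \<oplus>\<^bsub>M\<^esub> k \<in> K" "l' \<oplus>\<^bsub>M\<^esub> \<ominus>\<^bsub>M\<^esub> l \<in> L"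
    using s assms(2-5) submodule_minus by (auto simp: submodule_iff)
  ultimately have "\<ominus>\<^bsub>M\<^esub> k' \<oplus>\<^bsub>M\<^esub> k = \<zero>\<^bsub>M\<^esub>" using z by auto
  then have "\<ominus>\<^bsub>M\<^esub> k = \<ominus>\<^bsub>M\<^esub> k'" using c by (simp add: M.minus_equality)
  then show "k = k'" using c by (metis M.minus_minus)
  then show "l = l'" using assms(6) c by simp
qed

lemma binary_sum_psubset:
  assumes "binary_sum R M K L W" "L \<noteq> {\<zero>\<^bsub>M\<^esub>}"
  shows "K \<subset> W"
proof -
  have "K \<subseteq> W" "L \<subseteq> W" using assms binary_sum_subset binary_sum_commute by blast+
  moreover have "\<zero>\<^bsub>M\<^esub> \<in> L" "K \<inter> L = {\<zero>\<^bsub>M\<^esub>}" using assms by (auto simp: binary_sum_def submodule_iff)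
  ultimately show ?thesis using assms(2) by blast
qed

lemma set_add_assoc:
  assumes "U \<subseteq> carrier M" "Y \<subseteq> carrier M" "L \<subseteq> carrier M"
  shows "U <+>\<^bsub>M\<^esub> (Y <+>\<^bsub>M\<^esub> L) = (U <+>\<^bsub>M\<^esub> Y) <+>\<^bsub>M\<^esub> L"
  using M.add.set_mult_assoc[of U Y L] assms by (simp add: set_add_def)

text \<open>Reassociating \<open>(U \<oplus> Y) \<oplus> L\<close> to \<open>U \<oplus> (Y \<oplus> L)\<close>; this is why a summand of a summand is a
  summand.\<close>

lemma binary_sum_assoc:
  assumes UY: "binary_sum R M U Y K" and KL: "binary_sum R M K L W"
  shows "binary_sum R M U (Y <+>\<^bsub>M\<^esub> L) W" "binary_sum R M Y L (Y <+>\<^bsub>M\<^esub> L)"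
proof -
  have s: "submodule U R M" "submodule Y R M" "submodule L R M" "U <+>\<^bsub>M\<^esub> Y = K" "U \<inter> Y = {\<zero>\<^bsub>M\<^esub>}"
    "K \<inter> L = {\<zero>\<^bsub>M\<^esub>}" "K <+>\<^bsub>M\<^esub> L = W"
    using assms by (auto simp: binary_sum_def)
  then have c: "U \<subseteq> carrier M" "Y \<subseteq> carrier M" "L \<subseteq> carrier M"
    and z: "\<zero>\<^bsub>M\<^esub> \<in> U" "\<zero>\<^bsub>M\<^esub> \<in> Y" "\<zero>\<^bsub>M\<^esub> \<in> L"
    by (auto simp: submodule_iff)
  have sub: "U \<subseteq> K" "Y \<subseteq> K"
    using UY binary_sum_subset binary_sum_commute by blast+
  show "binary_sum R M Y L (Y <+>\<^bsub>M\<^esub> L)"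
    using s z sub by (auto simp: binary_sum_def)
  have "x = \<zero>\<^bsub>M\<^esub>" if x: "x \<in> U" "x \<in> Y <+>\<^bsub>M\<^esub> L" for x
  proof -
    obtain y l where yl: "y \<in> Y" "l \<in> L" "x = y \<oplus>\<^bsub>M\<^esub> l" using x by (auto simp: set_add_iff)
    \<comment> \<open>Compare the two ways of writing \<open>x\<close> in \<open>K \<oplus> L\<close>.\<close>
    have "x = y"
      by (rule binary_sum_unique(1)[OF KL, of x y "\<zero>\<^bsub>M\<^esub>" l]) (use x yl z c sub in auto)
    then show ?thesis using x yl s by auto
  qed
  moreover have "\<zero>\<^bsub>M\<^esub> \<in> Y <+>\<^bsub>M\<^esub> L" using submodule_set_add[OF s(2,3)] by (auto simp: submodule_iff)
  ultimately have "U \<inter> (Y <+>\<^bsub>M\<^esub> L) = {\<zero>\<^bsub>M\<^esub>}" using z(1) by blast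
  then show "binary_sum R M U (Y <+>\<^bsub>M\<^esub> L) W"
    using s submodule_set_add[OF s(2,3)] set_add_assoc[OF c] by (simp add: binary_sum_def)
qed

text \<open>The modular law: a summand of \<open>W\<close> is a summand of each submodule between it and \<open>W\<close>.
  The component in \<open>Y\<close> of an element of \<open>K\<close> differs from it by an element of \<open>U \<subseteq> K\<close>, and hence
  lies in \<open>K\<close>.\<close>

lemma binary_sum_modular:
  assumes UY: "binary_sum R M U Y W" and K: "submodule K R M" "U \<subseteq> K" "K \<subseteq> W"
  shows "binary_sum R M U (K \<inter> Y) K"
proof -
  have s: "submodule U R M" "submodule Y R M" "U \<inter> Y = {\<zero>\<^bsub>M\<^esub>}" "U <+>\<^bsub>M\<^esub> Y = W"
    using UY by (auto simp: binary_sum_def)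
  then have z: "\<zero>\<^bsub>M\<^esub> \<in> K" "\<zero>\<^bsub>M\<^esub> \<in> U" "\<zero>\<^bsub>M\<^esub> \<in> Y" using K by (auto simp: submodule_iff)
  have "k \<in> U <+>\<^bsub>M\<^esub> (K \<inter> Y)" if k: "k \<in> K" for k
  proof -
    have "k \<in> U <+>\<^bsub>M\<^esub> Y" using k K(3) s(4) by blast
    then obtain x y where xy: "x \<in> U" "y \<in> Y" "k = x \<oplus>\<^bsub>M\<^esub> y"
      unfolding set_add_iff by blast
    have c: "x \<in> carrier M" "y \<in> carrier M" using xy s by (auto simp: submodule_iff)
    have "y = \<ominus>\<^bsub>M\<^esub> x \<oplus>\<^bsub>M\<^esub> k" using xy c by (simp add: M.a_assoc[symmetric] M.l_neg)
    moreover have "\<ominus>\<^bsub>M\<^esub> x \<in> K" using xy K submodule_minus by blast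
    ultimately have "y \<in> K" using k K(1) by (auto simp: submodule_iff)
    then show ?thesis using xy by (auto simp: set_add_iff)
  qed
  moreover have "U <+>\<^bsub>M\<^esub> (K \<inter> Y) \<subseteq> K"
    using K(1,2) unfolding submodule_iff set_add_iff subset_iff by blast
  ultimately have "U <+>\<^bsub>M\<^esub> (K \<inter> Y) = K" by blast
  moreover have "U \<inter> (K \<inter> Y) = {\<zero>\<^bsub>M\<^esub>}" using s(3) K(2) by blast
  ultimately show ?thesis using s(1,2) K(1) submodule_Int by (simp add: binary_sum_def)
qed

lemma linear_iso_image_submodule:
  assumes f: "linear_iso R M f K K'" and s: "submodule K R M" "submodule K' R M"
    "submodule U R M" "U \<subseteq> K"
  shows "submodule (f ` U) R M"
proof -
  have U: "\<zero>\<^bsub>M\<^esub> \<in> U" "\<And>x y. x \<in> U \<Longrightarrow> y \<in> U \<Longrightarrow> x \<oplus>\<^bsub>M\<^esub> y \<in> U"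
    "\<And>a x. a \<in> carrier R \<Longrightarrow> x \<in> U \<Longrightarrow> a \<odot>\<^bsub>M\<^esub> x \<in> U"
    using s(3) by (auto simp: submodule_iff)
  have K': "f ` U \<subseteq> carrier M"
    using f s by (auto simp: linear_iso_def bij_betw_def submodule_iff)
  have add: "f (x \<oplus>\<^bsub>M\<^esub> y) = f x \<oplus>\<^bsub>M\<^esub> f y" if "x \<in> U" "y \<in> U" for x y
    using f subsetD[OF s(4)] that by (simp add: linear_iso_def)
  have smult: "f (a \<odot>\<^bsub>M\<^esub> x) = a \<odot>\<^bsub>M\<^esub> f x" if "a \<in> carrier R" "x \<in> U" for a x
    using f subsetD[OF s(4)] that by (simp add: linear_iso_def)
  have "f \<zero>\<^bsub>M\<^esub> = f (\<zero> \<odot>\<^bsub>M\<^esub> \<zero>\<^bsub>M\<^esub>)" by (simp add: smult_l_zero)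
  also have "\<dots> = \<zero> \<odot>\<^bsub>M\<^esub> f \<zero>\<^bsub>M\<^esub>" using smult U by simp
  also have "\<dots> = \<zero>\<^bsub>M\<^esub>" using U K' by (intro smult_l_zero) auto
  finally have "\<zero>\<^bsub>M\<^esub> \<in> f ` U" using U by (metis imageI)
  moreover have "f x \<oplus>\<^bsub>M\<^esub> f y \<in> f ` U" if "x \<in> U" "y \<in> U" for x y
    unfolding add[OF that, symmetric] using U(2)[OF that] by (rule imageI)
  moreover have "a \<odot>\<^bsub>M\<^esub> f x \<in> f ` U" if "a \<in> carrier R" "x \<in> U" for a x
    unfolding smult[OF that, symmetric] using U(3)[OF that] by (rule imageI)
  ultimately show ?thesis
    unfolding submodule_iff using K' by blast
qed

lemma linear_iso_image_binary_sum:
  assumes f: "linear_iso R M f K K'" and s: "submodule K' R M" and UY: "binary_sum R M U Y K"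
  shows "binary_sum R M (f ` U) (f ` Y) K'"
proof -
  note sm = binary_sum_submodule[OF UY]
  have sub: "U \<subseteq> K" "Y \<subseteq> K" using UY binary_sum_subset binary_sum_commute by blast+
  have im: "submodule (f ` U) R M" "submodule (f ` Y) R M"
    using linear_iso_image_submodule[OF f] s sm sub by auto
  have b: "inj_on f K" "f ` K = K'" using f by (auto simp: linear_iso_def bij_betw_def)
  have "f ` U \<inter> f ` Y = f ` (U \<inter> Y)" using inj_on_image_Int[OF b(1) sub] ..
  also have "\<dots> = {f \<zero>\<^bsub>M\<^esub>}" using UY by (auto simp: binary_sum_def)
  finally have "f ` U \<inter> f ` Y = {f \<zero>\<^bsub>M\<^esub>}" .
  moreover have "\<zero>\<^bsub>M\<^esub> \<in> f ` U" "\<zero>\<^bsub>M\<^esub> \<in> f ` Y" using im by (simp_all add: submodule_iff)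
  ultimately have "f ` U \<inter> f ` Y = {\<zero>\<^bsub>M\<^esub>}" by (metis IntI singletonD)
  moreover have "f ` U <+>\<^bsub>M\<^esub> f ` Y = f ` (U <+>\<^bsub>M\<^esub> Y)"
  proof -
    have "f (x \<oplus>\<^bsub>M\<^esub> y) = f x \<oplus>\<^bsub>M\<^esub> f y" if "x \<in> U" "y \<in> Y" for x y
      using f subsetD[OF sub(1)] subsetD[OF sub(2)] that by (simp add: linear_iso_def)
    then show ?thesis by (simp add: set_add_def' image_UN cong: SUP_cong)
  qed
  moreover have "U <+>\<^bsub>M\<^esub> Y = K" using UY by (auto simp: binary_sum_def)
  ultimately show ?thesis using im b by (simp add: binary_sum_def)
qed

lemma submodule_isomorphic_sym:
  assumes "submodule_isomorphic R M K L" "submodule K R M"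
  shows "submodule_isomorphic R M L K"
proof -
  obtain f where f: "linear_iso R M f K L" using assms submodule_isomorphic_iff_linear_iso by blast
  let ?g = "inv_into K f"
  have b: "bij_betw f K L" using f by (auto simp: linear_iso_def)
  have g: "?g y \<in> K" "f (?g y) = y" if "y \<in> L" for y
    using b that by (auto simp: bij_betw_def inv_into_into f_inv_into_f)
  have eq: "?g y = x" if "x \<in> K" "f x = y" for x y
    using b that by (auto simp: bij_betw_def)
  have "linear_iso R M ?g L K"
    unfolding linear_iso_def using f assms(2) g
    by (auto simp: linear_iso_def bij_betw_inv_into submodule_iff intro!: eq)
  then show ?thesis using submodule_isomorphic_iff_linear_iso by blast
qed

text \<open>The isomorphism acts on the two components separately; uniqueness of components makes it
  well defined and injective.\<close>

lemma binary_sum_isomorphic: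
  assumes UK: "binary_sum R M U K V" and YL: "binary_sum R M Y L W"
    and iso: "submodule_isomorphic R M U Y" "submodule_isomorphic R M K L"
  shows "submodule_isomorphic R M V W"
proof -
  obtain f g where f: "linear_iso R M f U Y" and g: "linear_iso R M g K L"
    using iso submodule_isomorphic_iff_linear_iso by blast
  note sm = binary_sum_submodule[OF UK] binary_sum_submodule[OF YL]
  \<comment> \<open>\<open>p v\<close> is the pair of components of \<open>v\<close>.\<close>
  define p where "p v = (SOME xk. fst xk \<in> U \<and> snd xk \<in> K \<and> v = fst xk \<oplus>\<^bsub>M\<^esub> snd xk)" for v
  define h where "h v = f (fst (p v)) \<oplus>\<^bsub>M\<^esub> g (snd (p v))" for v
  have h: "h (x \<oplus>\<^bsub>M\<^esub> k) = f x \<oplus>\<^bsub>M\<^esub> g k" if "x \<in> U" "k \<in> K" for x k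
  proof -
    have "fst (p (x \<oplus>\<^bsub>M\<^esub> k)) \<in> U \<and> snd (p (x \<oplus>\<^bsub>M\<^esub> k)) \<in> K \<and>
        x \<oplus>\<^bsub>M\<^esub> k = fst (p (x \<oplus>\<^bsub>M\<^esub> k)) \<oplus>\<^bsub>M\<^esub> snd (p (x \<oplus>\<^bsub>M\<^esub> k))"
      unfolding p_def by (rule someI[of _ "(x, k)"]) (use that in auto)
    then have "fst (p (x \<oplus>\<^bsub>M\<^esub> k)) = x" "snd (p (x \<oplus>\<^bsub>M\<^esub> k)) = k"
      using binary_sum_unique[OF UK] that by metis+
    then show ?thesis by (simp add: h_def)
  qed
  have V: "\<exists>x\<in>U. \<exists>k\<in>K. v = x \<oplus>\<^bsub>M\<^esub> k" if "v \<in> V" for v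
    using UK that by (auto simp: binary_sum_def set_add_iff)
  have bf: "inj_on f U" "f ` U = Y" "inj_on g K" "g ` K = L"
    using f g by (auto simp: linear_iso_def bij_betw_def)
  have c: "U \<subseteq> carrier M" "K \<subseteq> carrier M" "Y \<subseteq> carrier M" "L \<subseteq> carrier M"
    using sm by (auto simp: submodule_iff)
  have fU: "f x \<in> Y" "f x \<in> carrier M" "x \<in> carrier M" if "x \<in> U" for x using bf c that by auto
  have gK: "g x \<in> L" "g x \<in> carrier M" "x \<in> carrier M" if "x \<in> K" for x using bf c that by auto
  have "inj_on h V"
  proof (rule inj_onI)
    fix v w assume vw: "v \<in> V" "w \<in> V" and e: "h v = h w"
    obtain x k x' k' where d: "x \<in> U" "k \<in> K" "v = x \<oplus>\<^bsub>M\<^esub> k" "x' \<in> U" "k' \<in> K" "w = x' \<oplus>\<^bsub>M\<^esub> k'"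
      using V vw by metis
    have "f x \<oplus>\<^bsub>M\<^esub> g k = f x' \<oplus>\<^bsub>M\<^esub> g k'" using e d h by simp
    then have "f x = f x'" "g k = g k'"
      using binary_sum_unique[OF YL] d fU gK by metis+
    then show "v = w" using d bf by (auto dest: inj_onD)
  qed
  moreover have "h ` V = W"
  proof -
    have "V = U <+>\<^bsub>M\<^esub> K" "W = Y <+>\<^bsub>M\<^esub> L" using UK YL by (auto simp: binary_sum_def)
    then have "h ` V = (\<Union>x\<in>U. \<Union>k\<in>K. {f x \<oplus>\<^bsub>M\<^esub> g k})" using h by (simp add: set_add_def' image_UN cong: SUP_cong)
    then show ?thesis using \<open>W = _\<close> bf(2,4) by (auto simp: set_add_def')
  qed
  moreover have "h (v \<oplus>\<^bsub>M\<^esub> w) = h v \<oplus>\<^bsub>M\<^esub> h w" if vw: "v \<in> V" "w \<in> V" for v w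
  proof -
    obtain x k x' k' where d: "x \<in> U" "k \<in> K" "v = x \<oplus>\<^bsub>M\<^esub> k" "x' \<in> U" "k' \<in> K" "w = x' \<oplus>\<^bsub>M\<^esub> k'"
      using V vw by metis
    have "v \<oplus>\<^bsub>M\<^esub> w = (x \<oplus>\<^bsub>M\<^esub> x') \<oplus>\<^bsub>M\<^esub> (k \<oplus>\<^bsub>M\<^esub> k')" using d fU gK by (simp add: M.a_ac)
    moreover have "x \<oplus>\<^bsub>M\<^esub> x' \<in> U" "k \<oplus>\<^bsub>M\<^esub> k' \<in> K" using d sm by (auto simp: submodule_iff)
    ultimately have "h (v \<oplus>\<^bsub>M\<^esub> w) = (f x \<oplus>\<^bsub>M\<^esub> f x') \<oplus>\<^bsub>M\<^esub> (g k \<oplus>\<^bsub>M\<^esub> g k')"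
      using h d f g by (simp add: linear_iso_def)
    also have "\<dots> = h v \<oplus>\<^bsub>M\<^esub> h w"
      unfolding d(3,6) h[OF d(1,2)] h[OF d(4,5)] using d(1,2,4,5) fU gK by (simp add: M.a_ac)
    finally show ?thesis .
  qed
  moreover have "h (a \<odot>\<^bsub>M\<^esub> v) = a \<odot>\<^bsub>M\<^esub> h v" if a: "a \<in> carrier R" and v: "v \<in> V" for a v
  proof -
    obtain x k where d: "x \<in> U" "k \<in> K" "v = x \<oplus>\<^bsub>M\<^esub> k" using V v by metis
    have "a \<odot>\<^bsub>M\<^esub> v = a \<odot>\<^bsub>M\<^esub> x \<oplus>\<^bsub>M\<^esub> a \<odot>\<^bsub>M\<^esub> k" using d fU gK a by (simp add: smult_r_distr)
    moreover have "a \<odot>\<^bsub>M\<^esub> x \<in> U" "a \<odot>\<^bsub>M\<^esub> k \<in> K" using d sm a by (auto simp: submodule_iff)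
    ultimately have "h (a \<odot>\<^bsub>M\<^esub> v) = a \<odot>\<^bsub>M\<^esub> f x \<oplus>\<^bsub>M\<^esub> a \<odot>\<^bsub>M\<^esub> g k"
      using h d f g a by (simp add: linear_iso_def)
    also have "\<dots> = a \<odot>\<^bsub>M\<^esub> h v" using d h fU gK a by (simp add: smult_r_distr)
    finally show ?thesis .
  qed
  ultimately have "linear_iso R M h V W" by (auto simp: linear_iso_def bij_betw_def)
  then show ?thesis using submodule_isomorphic_iff_linear_iso by blast
qed

lemma complementary_submodule_iff:
  assumes "submodule W R M"
  shows "complementary R (M\<lparr>carrier := W\<rparr>) K L \<longleftrightarrow> binary_sum R M K L W"
proof -
  have "K <+>\<^bsub>M\<lparr>carrier := W\<rparr>\<^esub> L = K <+>\<^bsub>M\<^esub> L" by (simp add: set_add_def')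
  then show ?thesis
    using binary_sum_subset[of K L W] binary_sum_subset[OF binary_sum_commute, of K L W]
    by (auto simp: complementary_def submodule_of_submodule_iff[OF assms] binary_sum_def)
qed

lemma direct_summands_iff: "K \<in> direct_summands R M \<longleftrightarrow> (\<exists>L. binary_sum R M K L (carrier M))"
  by (auto simp: direct_summands_def complementary_def binary_sum_def)

lemma summand_submodule: "K \<in> direct_summands R M \<Longrightarrow> submodule K R M"
  by (auto simp: direct_summands_iff dest: binary_sum_submodule)

lemma summand_trans:
  assumes "binary_sum R M U Y K" "K \<in> direct_summands R M"
  shows "U \<in> direct_summands R M"
  using assms binary_sum_assoc(1) unfolding direct_summands_iff by blast

end

section \<open>Internal direct sums of families\<close>

text \<open>The notion of a direct sum decomposition with an arbitrary subset \<open>K\<close> in place of the whole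
  module. It has to be available for submodules because partial sums and decompositions of summands
  are to be moved in and out of \<open>M\<close>, and the sums in the direct sum map are always taken in \<open>M\<close>.\<close>

definition internal_sum ::
    "('a, 'r) ring_scheme \<Rightarrow> ('a, 'b, 'm) module_scheme \<Rightarrow> 'i set \<Rightarrow> ('i \<Rightarrow> 'b set) \<Rightarrow> 'b set \<Rightarrow> bool" where
  "internal_sum R M A N K \<longleftrightarrow>
    (\<forall>\<alpha>\<in>A. submodule (N \<alpha>) R M \<and> N \<alpha> \<noteq> {\<zero>\<^bsub>M\<^esub>}) \<and>
    bij_betw (direct_sum_map M A) (external_direct_sum M A N) K"

text \<open>The identification of the external direct sum over a disjoint union \<open>A \<union> B\<close> with the product
  of those over \<open>A\<close> and \<open>B\<close>.\<close>

definition glue :: "'i set \<Rightarrow> 'i set \<Rightarrow> ('i \<Rightarrow> 'b) \<Rightarrow> ('i \<Rightarrow> 'b) \<Rightarrow> 'i \<Rightarrow> 'b" where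
  "glue A B x y = (\<lambda>\<alpha>\<in>A \<union> B. if \<alpha> \<in> A then x \<alpha> else y \<alpha>)"

lemma direct_sum_decomposition_iff_internal_sum:
  "direct_sum_decomposition R M A N \<longleftrightarrow> internal_sum R M A N (carrier M)"
  by (simp add: direct_sum_decomposition_def internal_sum_def)

lemma external_direct_sum_iff:
  "x \<in> external_direct_sum M A N \<longleftrightarrow>
    x \<in> extensional A \<and> (\<forall>\<alpha>\<in>A. x \<alpha> \<in> N \<alpha>) \<and> finite {\<alpha> \<in> A. x \<alpha> \<noteq> \<zero>\<^bsub>M\<^esub>}"
  by (auto simp: external_direct_sum_def PiE_def)

context left_module
begin

lemma finsum_smult:
  assumes "finite F" "x \<in> F \<rightarrow> carrier M" "a \<in> carrier R"
  shows "a \<odot>\<^bsub>M\<^esub> finsum M x F = finsum M (\<lambda>i. a \<odot>\<^bsub>M\<^esub> x i) F"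
  using assms
proof (induction F)
  case empty
  then show ?case by (simp add: smult_r_zero)
next
  case (insert i F)
  then show ?case by (simp add: smult_r_distr Pi_iff)
qed

text \<open>Sums over a common finite index set are needed to add two families with different
  supports.\<close>

lemma direct_sum_map_eq_finsum:
  assumes "finite F" "F \<subseteq> A" "{\<alpha> \<in> A. x \<alpha> \<noteq> \<zero>\<^bsub>M\<^esub>} \<subseteq> F" "\<And>\<alpha>. \<alpha> \<in> A \<Longrightarrow> x \<alpha> \<in> carrier M"
  shows "direct_sum_map M A x = finsum M x F"
  unfolding direct_sum_map_def
  by (rule M.add.finprod_mono_neutral_cong_left) (use assms in auto)

lemma direct_sum_map_zero: "direct_sum_map M A (\<lambda>\<alpha>\<in>A. \<zero>\<^bsub>M\<^esub>) = \<zero>\<^bsub>M\<^esub>"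
  by (subst direct_sum_map_eq_finsum[of "{}"]) auto

lemma zero_external_direct_sum:
  assumes "\<And>\<alpha>. \<alpha> \<in> A \<Longrightarrow> submodule (N \<alpha>) R M"
  shows "(\<lambda>\<alpha>\<in>A. \<zero>\<^bsub>M\<^esub>) \<in> external_direct_sum M A N"
  using assms by (auto simp: external_direct_sum_iff submodule_iff cong: conj_cong)

lemma submodule_direct_sum_map_image:
  assumes "\<And>\<alpha>. \<alpha> \<in> A \<Longrightarrow> submodule (N \<alpha>) R M"
  shows "submodule (direct_sum_map M A ` external_direct_sum M A N) R M"
proof -
  let ?E = "external_direct_sum M A N" and ?S = "\<lambda>x. {\<alpha> \<in> A. x \<alpha> \<noteq> \<zero>\<^bsub>M\<^esub>}"
  have c: "z \<in> carrier M" if "\<alpha> \<in> A" "z \<in> N \<alpha>" for \<alpha> z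
    using assms[OF that(1)] that(2) by (auto simp: submodule_iff)
  have E: "x \<alpha> \<in> N \<alpha>" "x \<alpha> \<in> carrier M" "finite (?S x)" if "x \<in> ?E" "\<alpha> \<in> A" for x \<alpha>
    using that c by (auto simp: external_direct_sum_iff)
  have fin: "finite (?S x)" if "x \<in> ?E" for x using that by (simp add: external_direct_sum_iff)
  have "direct_sum_map M A x \<in> carrier M" if "x \<in> ?E" for x
    unfolding direct_sum_map_def by (rule M.finsum_closed) (use E that in auto)
  moreover have "\<zero>\<^bsub>M\<^esub> \<in> direct_sum_map M A ` ?E"
    by (rule image_eqI[OF _ zero_external_direct_sum]) (simp_all add: direct_sum_map_zero assms)
  moreover have "direct_sum_map M A x \<oplus>\<^bsub>M\<^esub> direct_sum_map M A y \<in> direct_sum_map M A ` ?E"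
    if xy: "x \<in> ?E" "y \<in> ?E" for x y
  proof (rule image_eqI)
    let ?z = "\<lambda>\<alpha>\<in>A. x \<alpha> \<oplus>\<^bsub>M\<^esub> y \<alpha>" and ?F = "?S x \<union> ?S y"
    have F: "finite ?F" "?F \<subseteq> A" "?S x \<subseteq> ?F" "?S y \<subseteq> ?F" "?S ?z \<subseteq> ?F" using fin xy by auto
    have "x \<alpha> \<oplus>\<^bsub>M\<^esub> y \<alpha> \<in> N \<alpha>" if "\<alpha> \<in> A" for \<alpha>
      using assms[OF that] E(1)[OF xy(1) that] E(1)[OF xy(2) that] by (simp add: submodule_iff)
    then show "?z \<in> ?E"
      using finite_subset[OF F(5,1)] by (simp add: external_direct_sum_iff)
    have "direct_sum_map M A ?z = finsum M ?z ?F"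
      by (rule direct_sum_map_eq_finsum[OF F(1,2,5)]) (use E xy in auto)
    also have "\<dots> = finsum M (\<lambda>\<alpha>. x \<alpha> \<oplus>\<^bsub>M\<^esub> y \<alpha>) ?F"
      by (rule M.finsum_cong') (use E xy in auto)
    also have "\<dots> = finsum M x ?F \<oplus>\<^bsub>M\<^esub> finsum M y ?F"
      by (rule M.finsum_addf) (use E xy in auto)
    finally show "direct_sum_map M A x \<oplus>\<^bsub>M\<^esub> direct_sum_map M A y = direct_sum_map M A ?z"
      using direct_sum_map_eq_finsum[OF F(1,2,3)] direct_sum_map_eq_finsum[OF F(1,2,4)] E xy by simp
  qed
  moreover have "a \<odot>\<^bsub>M\<^esub> direct_sum_map M A x \<in> direct_sum_map M A ` ?E"
    if a: "a \<in> carrier R" and x: "x \<in> ?E" for a x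
  proof (rule image_eqI)
    let ?z = "\<lambda>\<alpha>\<in>A. a \<odot>\<^bsub>M\<^esub> x \<alpha>"
    have F: "finite (?S x)" "?S x \<subseteq> A" "?S ?z \<subseteq> ?S x" using fin x a smult_r_zero by auto
    have "a \<odot>\<^bsub>M\<^esub> x \<alpha> \<in> N \<alpha>" if "\<alpha> \<in> A" for \<alpha>
      using assms[OF that] E(1)[OF x that] a by (simp add: submodule_iff)
    then show "?z \<in> ?E"
      using finite_subset[OF F(3,1)] by (simp add: external_direct_sum_iff)
    have "direct_sum_map M A ?z = finsum M ?z (?S x)"
      by (rule direct_sum_map_eq_finsum[OF F]) (use E x a in auto)
    also have "\<dots> = finsum M (\<lambda>\<alpha>. a \<odot>\<^bsub>M\<^esub> x \<alpha>) (?S x)"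
      by (rule M.finsum_cong') (use E x a in auto)
    also have "\<dots> = a \<odot>\<^bsub>M\<^esub> direct_sum_map M A x"
      unfolding direct_sum_map_def by (rule finsum_smult[symmetric]) (use E x a F in auto)
    finally show "a \<odot>\<^bsub>M\<^esub> direct_sum_map M A x = direct_sum_map M A ?z" ..
  qed
  ultimately show ?thesis unfolding submodule_iff by blast
qed

lemma glue_external_direct_sum:
  assumes x: "x \<in> external_direct_sum M A N" and y: "y \<in> external_direct_sum M B N"
    and disj: "A \<inter> B = {}"
    and sub: "\<And>\<alpha>. \<alpha> \<in> A \<union> B \<Longrightarrow> submodule (N \<alpha>) R M"
  shows "glue A B x y \<in> external_direct_sum M (A \<union> B) N"
    and "direct_sum_map M (A \<union> B) (glue A B x y) = direct_sum_map M A x \<oplus>\<^bsub>M\<^esub> direct_sum_map M B y"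
proof -
  let ?j = "glue A B x y"
  have jA: "?j \<alpha> = x \<alpha>" if "\<alpha> \<in> A" for \<alpha> using that by (simp add: glue_def)
  have jB: "?j \<alpha> = y \<alpha>" if "\<alpha> \<in> B" for \<alpha> using that disj by (auto simp: glue_def)
  have S: "{\<alpha> \<in> A \<union> B. ?j \<alpha> \<noteq> \<zero>\<^bsub>M\<^esub>} = {\<alpha> \<in> A. x \<alpha> \<noteq> \<zero>\<^bsub>M\<^esub>} \<union> {\<alpha> \<in> B. y \<alpha> \<noteq> \<zero>\<^bsub>M\<^esub>}"
    using jA jB by auto
  have fin: "finite {\<alpha> \<in> A. x \<alpha> \<noteq> \<zero>\<^bsub>M\<^esub>}" "finite {\<alpha> \<in> B. y \<alpha> \<noteq> \<zero>\<^bsub>M\<^esub>}"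
    using x y by (simp_all add: external_direct_sum_iff)
  have c: "x \<alpha> \<in> carrier M" if "\<alpha> \<in> A" for \<alpha>
    using sub[of \<alpha>] x that by (auto simp: submodule_iff external_direct_sum_iff)
  have d: "y \<alpha> \<in> carrier M" if "\<alpha> \<in> B" for \<alpha>
    using sub[of \<alpha>] y that by (auto simp: submodule_iff external_direct_sum_iff)
  have ext: "?j \<in> extensional (A \<union> B)" by (simp add: glue_def)
  have "?j \<alpha> \<in> N \<alpha>" if "\<alpha> \<in> A \<union> B" for \<alpha>
    using that jA[of \<alpha>] jB[of \<alpha>] x y by (auto simp: external_direct_sum_iff)
  then show "?j \<in> external_direct_sum M (A \<union> B) N"
    unfolding external_direct_sum_iff S using ext fin by simp
  have "direct_sum_map M (A \<union> B) ?j =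
      finsum M ?j {\<alpha> \<in> A. x \<alpha> \<noteq> \<zero>\<^bsub>M\<^esub>} \<oplus>\<^bsub>M\<^esub> finsum M ?j {\<alpha> \<in> B. y \<alpha> \<noteq> \<zero>\<^bsub>M\<^esub>}"
    unfolding direct_sum_map_def S
    by (rule M.finsum_Un_disjoint) (use fin disj jA jB c d in auto)
  also have "finsum M ?j {\<alpha> \<in> A. x \<alpha> \<noteq> \<zero>\<^bsub>M\<^esub>} = direct_sum_map M A x"
    unfolding direct_sum_map_def by (rule M.finsum_cong') (use jA c in auto)
  also have "finsum M ?j {\<alpha> \<in> B. y \<alpha> \<noteq> \<zero>\<^bsub>M\<^esub>} = direct_sum_map M B y"
    unfolding direct_sum_map_def by (rule M.finsum_cong') (use jB d in auto)
  finally show "direct_sum_map M (A \<union> B) ?j = direct_sum_map M A x \<oplus>\<^bsub>M\<^esub> direct_sum_map M B y" .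
qed

lemma glue_inject:
  assumes "glue A B x y = glue A B x' y'" "A \<inter> B = {}"
    "x \<in> external_direct_sum M A N" "x' \<in> external_direct_sum M A N"
    "y \<in> external_direct_sum M B N" "y' \<in> external_direct_sum M B N"
  shows "x = x'" "y = y'"
proof -
  have e: "glue A B x y \<alpha> = glue A B x' y' \<alpha>" for \<alpha> using assms(1) by simp
  show "x = x'"
  proof (rule extensionalityI[of _ A])
    show "x \<alpha> = x' \<alpha>" if "\<alpha> \<in> A" for \<alpha> using e[of \<alpha>] that by (simp add: glue_def)
  qed (use assms in \<open>auto simp: external_direct_sum_iff\<close>)
  show "y = y'"
  proof (rule extensionalityI[of _ B])
    show "y \<alpha> = y' \<alpha>" if "\<alpha> \<in> B" for \<alpha>
      using e[of \<alpha>] that assms(2) by (auto simp: glue_def split: if_splits)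
  qed (use assms in \<open>auto simp: external_direct_sum_iff\<close>)
qed

lemma glue_cases:
  assumes z: "z \<in> external_direct_sum M (A \<union> B) N"
  obtains x y where "x \<in> external_direct_sum M A N" "y \<in> external_direct_sum M B N" "z = glue A B x y"
proof
  have "finite {\<alpha> \<in> A. restrict z A \<alpha> \<noteq> \<zero>\<^bsub>M\<^esub>}" "finite {\<alpha> \<in> B. restrict z B \<alpha> \<noteq> \<zero>\<^bsub>M\<^esub>}"
    using z by (auto simp: external_direct_sum_iff elim!: rev_finite_subset)
  then show "restrict z A \<in> external_direct_sum M A N" "restrict z B \<in> external_direct_sum M B N"
    using z by (auto simp: external_direct_sum_iff)
  show "z = glue A B (restrict z A) (restrict z B)"
    by (rule extensionalityI[of _ "A \<union> B"])
      (use z in \<open>auto simp: external_direct_sum_iff glue_def\<close>)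
qed

text \<open>Under gluing, the direct sum map over \<open>A \<union> B\<close> becomes addition after the pair of the direct
  sum maps over \<open>A\<close> and \<open>B\<close>; so it is bijective when these two and addition \<open>K \<times> L \<rightarrow> W\<close> are.\<close>

lemma internal_sum_Un:
  assumes A: "internal_sum R M A N K" and B: "internal_sum R M B N L"
    and disj: "A \<inter> B = {}" and KL: "binary_sum R M K L W"
  shows "internal_sum R M (A \<union> B) N W"
proof -
  let ?E = "\<lambda>A. external_direct_sum M A N" and ?s = "direct_sum_map M"
  have bA: "inj_on (?s A) (?E A)" "?s A ` ?E A = K" and bB: "inj_on (?s B) (?E B)" "?s B ` ?E B = L"
    using A B by (auto simp: internal_sum_def bij_betw_def)
  have sub: "submodule (N \<alpha>) R M" if "\<alpha> \<in> A \<union> B" for \<alpha>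
    using A B that by (auto simp: internal_sum_def)
  note j = glue_external_direct_sum[OF _ _ disj sub]
  have W: "W = K <+>\<^bsub>M\<^esub> L" using KL by (simp add: binary_sum_def)
  have "inj_on (?s (A \<union> B)) (?E (A \<union> B))"
  proof (rule inj_onI)
    fix z z' assume z: "z \<in> ?E (A \<union> B)" "z' \<in> ?E (A \<union> B)" and e: "?s (A \<union> B) z = ?s (A \<union> B) z'"
    obtain x y where xy: "x \<in> ?E A" "y \<in> ?E B" "z = glue A B x y" using glue_cases[OF z(1)] .
    obtain x' y' where xy': "x' \<in> ?E A" "y' \<in> ?E B" "z' = glue A B x' y'" using glue_cases[OF z(2)] .
    have "?s A x \<oplus>\<^bsub>M\<^esub> ?s B y = ?s A x' \<oplus>\<^bsub>M\<^esub> ?s B y'"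
      using e j(2)[OF xy(1,2)] j(2)[OF xy'(1,2)] xy(3) xy'(3) by simp
    moreover have "?s A x \<in> K" "?s A x' \<in> K" "?s B y \<in> L" "?s B y' \<in> L"
      using xy xy' bA bB by auto
    ultimately have "?s A x = ?s A x'" "?s B y = ?s B y'"
      using binary_sum_unique[OF KL] by metis+
    then show "z = z'" using xy xy' bA(1) bB(1) by (auto dest: inj_onD)
  qed
  moreover have "?s (A \<union> B) ` ?E (A \<union> B) = W"
  proof (intro equalityI subsetI)
    fix w assume "w \<in> ?s (A \<union> B) ` ?E (A \<union> B)"
    then obtain z where z: "z \<in> ?E (A \<union> B)" "w = ?s (A \<union> B) z" by blast
    obtain x y where xy: "x \<in> ?E A" "y \<in> ?E B" "z = glue A B x y" using glue_cases[OF z(1)] .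
    have "w = ?s A x \<oplus>\<^bsub>M\<^esub> ?s B y" using z xy j(2)[OF xy(1,2)] by simp
    then show "w \<in> W" unfolding W set_add_iff using xy bA bB by blast
  next
    fix w assume "w \<in> W"
    then obtain k l where "k \<in> K" "l \<in> L" "w = k \<oplus>\<^bsub>M\<^esub> l" unfolding W set_add_iff by blast
    then obtain x y where "x \<in> ?E A" "y \<in> ?E B" "w = ?s A x \<oplus>\<^bsub>M\<^esub> ?s B y"
      using bA bB by blast
    then show "w \<in> ?s (A \<union> B) ` ?E (A \<union> B)" using j by force
  qed
  ultimately show ?thesis using A B by (auto simp: internal_sum_def bij_betw_def)
qed

text \<open>The converse, with the partial sums for \<open>K\<close> and \<open>L\<close>. Injectivity of the direct sum map over
  \<open>A \<union> B\<close>, applied to families that vanish on \<open>A\<close> or on \<open>B\<close>, gives both the injectivity of the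
  two restrictions and \<open>K \<inter> L = 0\<close>.\<close>

lemma internal_sum_Un_split:
  assumes AB: "internal_sum R M (A \<union> B) N W" and disj: "A \<inter> B = {}"
  obtains K L where "internal_sum R M A N K" "internal_sum R M B N L" "binary_sum R M K L W"
proof -
  let ?E = "\<lambda>A. external_direct_sum M A N" and ?s = "direct_sum_map M"
  let ?z = "\<lambda>A. \<lambda>\<alpha>\<in>A. \<zero>\<^bsub>M\<^esub>"
  have b: "inj_on (?s (A \<union> B)) (?E (A \<union> B))" "?s (A \<union> B) ` ?E (A \<union> B) = W"
    using AB by (auto simp: internal_sum_def bij_betw_def)
  have sub: "submodule (N \<alpha>) R M" if "\<alpha> \<in> A \<union> B" for \<alpha>
    using AB that by (auto simp: internal_sum_def)
  note j = glue_external_direct_sum[OF _ _ disj sub]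
  have K: "submodule (?s A ` ?E A) R M" and L: "submodule (?s B ` ?E B) R M"
    using sub by (auto intro: submodule_direct_sum_map_image)
  have z: "?z A \<in> ?E A" "?z B \<in> ?E B"
    using sub zero_external_direct_sum[of A N] zero_external_direct_sum[of B N] by auto
  have c: "?s A x \<in> carrier M" if "x \<in> ?E A" for x using K that by (auto simp: submodule_iff)
  have d: "?s B y \<in> carrier M" if "y \<in> ?E B" for y using L that by (auto simp: submodule_iff)
  have unique: "x = x' \<and> y = y'" if xy: "x \<in> ?E A" "y \<in> ?E B" "x' \<in> ?E A" "y' \<in> ?E B"
    and e: "?s A x \<oplus>\<^bsub>M\<^esub> ?s B y = ?s A x' \<oplus>\<^bsub>M\<^esub> ?s B y'" for x y x' y'
  proof -
    have "?s (A \<union> B) (glue A B x y) = ?s (A \<union> B) (glue A B x' y')"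
      using e j(2)[OF xy(1,2)] j(2)[OF xy(3,4)] by simp
    then have "glue A B x y = glue A B x' y'"
      using b(1) j(1)[OF xy(1,2)] j(1)[OF xy(3,4)] by (auto dest: inj_onD)
    then show ?thesis using glue_inject[OF _ disj xy(1,3,2,4)] by blast
  qed
  have "inj_on (?s A) (?E A)" using unique[OF _ z(2) _ z(2)] by (auto intro: inj_onI)
  then have 1: "internal_sum R M A N (?s A ` ?E A)"
    using AB by (auto simp: internal_sum_def bij_betw_def)
  have "inj_on (?s B) (?E B)" using unique[OF z(1) _ z(1)] by (auto intro: inj_onI)
  then have 2: "internal_sum R M B N (?s B ` ?E B)"
    using AB by (auto simp: internal_sum_def bij_betw_def)
  have "?s A ` ?E A \<inter> ?s B ` ?E B \<subseteq> {\<zero>\<^bsub>M\<^esub>}"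
  proof
    fix w assume "w \<in> ?s A ` ?E A \<inter> ?s B ` ?E B"
    then obtain x y where xy: "x \<in> ?E A" "y \<in> ?E B" "w = ?s A x" "w = ?s B y" by blast
    then have "?s A x \<oplus>\<^bsub>M\<^esub> ?s B (?z B) = ?s A (?z A) \<oplus>\<^bsub>M\<^esub> ?s B y"
      using c[OF xy(1)] d[OF xy(2)] by (simp add: direct_sum_map_zero)
    then have "x = ?z A" using unique[OF xy(1) z(2) z(1) xy(2)] by blast
    then show "w \<in> {\<zero>\<^bsub>M\<^esub>}" using xy(3) by (simp add: direct_sum_map_zero)
  qed
  then have "?s A ` ?E A \<inter> ?s B ` ?E B = {\<zero>\<^bsub>M\<^esub>}"
    using K L by (auto simp: submodule_iff)
  moreover have "?s A ` ?E A <+>\<^bsub>M\<^esub> ?s B ` ?E B = W"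
  proof (intro equalityI subsetI)
    fix w assume "w \<in> ?s A ` ?E A <+>\<^bsub>M\<^esub> ?s B ` ?E B"
    then obtain x y where xy: "x \<in> ?E A" "y \<in> ?E B" "w = ?s A x \<oplus>\<^bsub>M\<^esub> ?s B y"
      unfolding set_add_iff by blast
    then have "w = ?s (A \<union> B) (glue A B x y)" using j(2)[OF xy(1,2)] by simp
    then show "w \<in> W" using j(1)[OF xy(1,2)] b(2) by blast
  next
    fix w assume "w \<in> W"
    then obtain v where v: "v \<in> ?E (A \<union> B)" "w = ?s (A \<union> B) v" using b(2) by blast
    obtain x y where xy: "x \<in> ?E A" "y \<in> ?E B" "v = glue A B x y" using glue_cases[OF v(1)] .
    have "w = ?s A x \<oplus>\<^bsub>M\<^esub> ?s B y" using v xy j(2)[OF xy(1,2)] by simp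
    then show "w \<in> ?s A ` ?E A <+>\<^bsub>M\<^esub> ?s B ` ?E B" unfolding set_add_iff using xy by blast
  qed
  ultimately have "binary_sum R M (?s A ` ?E A) (?s B ` ?E B) W"
    using K L by (simp add: binary_sum_def)
  with 1 2 that show ?thesis by blast
qed

lemma internal_sum_empty_iff: "internal_sum R M {} N K \<longleftrightarrow> K = {\<zero>\<^bsub>M\<^esub>}"
proof -
  have "external_direct_sum M {} N = {\<lambda>_. undefined}"
    by (auto simp: external_direct_sum_iff extensional_def)
  then show ?thesis by (auto simp: internal_sum_def bij_betw_def direct_sum_map_def)
qed

lemma internal_sum_single:
  assumes "submodule (N \<alpha>) R M" "N \<alpha> \<noteq> {\<zero>\<^bsub>M\<^esub>}"
  shows "internal_sum R M {\<alpha>} N (N \<alpha>)"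
proof -
  let ?E = "external_direct_sum M {\<alpha>} N"
  have val: "direct_sum_map M {\<alpha>} x = x \<alpha>" if "x \<in> ?E" for x
  proof -
    have "x \<alpha> \<in> carrier M" using that assms by (auto simp: external_direct_sum_iff submodule_iff)
    then show ?thesis
      by (subst direct_sum_map_eq_finsum[of "{\<alpha>}"]) auto
  qed
  have "inj_on (direct_sum_map M {\<alpha>}) ?E"
  proof (rule inj_onI)
    fix x y assume "x \<in> ?E" "y \<in> ?E" "direct_sum_map M {\<alpha>} x = direct_sum_map M {\<alpha>} y"
    then show "x = y"
      by (intro extensionalityI[of _ "{\<alpha>}"]) (auto simp: val external_direct_sum_iff)
  qed
  moreover have "direct_sum_map M {\<alpha>} ` ?E = N \<alpha>"
  proof (intro equalityI subsetI)
    fix w assume w: "w \<in> N \<alpha>"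
    have "(\<lambda>\<beta>\<in>{\<alpha>}. w) \<in> ?E" using w by (auto simp: external_direct_sum_iff)
    then show "w \<in> direct_sum_map M {\<alpha>} ` ?E" by (intro image_eqI[of _ _ "\<lambda>\<beta>\<in>{\<alpha>}. w"]) (auto simp: val)
  next
    fix w assume "w \<in> direct_sum_map M {\<alpha>} ` ?E"
    then show "w \<in> N \<alpha>" by (auto simp: val) (auto simp: external_direct_sum_iff)
  qed
  ultimately show ?thesis using assms by (auto simp: internal_sum_def bij_betw_def)
qed

lemma internal_sum_unique:
  "internal_sum R M A N K \<Longrightarrow> internal_sum R M A N L \<Longrightarrow> K = L"
  by (auto simp: internal_sum_def bij_betw_def)

end

section \<open>Finiteness up to an equivalence\<close>

lemma finite_up_to_representatives:
  assumes "finite_up_to r C" and refl: "\<And>x. x \<in> C \<Longrightarrow> r x x"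
  obtains T where "finite T" "T \<subseteq> C" "\<And>x. x \<in> C \<Longrightarrow> \<exists>t\<in>T. r t x"
proof
  let ?r = "{(x, y). x \<in> C \<and> y \<in> C \<and> r x y}"
  let ?t = "\<lambda>Q. SOME x. x \<in> C \<and> Q = ?r `` {x}"
  have t: "?t Q \<in> C \<and> Q = ?r `` {?t Q}" if "Q \<in> C // ?r" for Q
    by (rule someI_ex) (use that in \<open>auto elim!: quotientE\<close>)
  show "finite (?t ` (C // ?r))" using assms(1) by (simp add: finite_up_to_def)
  show "?t ` (C // ?r) \<subseteq> C" using t by blast
  show "\<exists>t\<in>?t ` (C // ?r). r t x" if x: "x \<in> C" for x
  proof -
    have Q: "?r `` {x} \<in> C // ?r" using x by (rule quotientI)
    have "x \<in> ?r `` {x}" using x refl by auto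
    then have "x \<in> ?r `` {?t (?r `` {x})}" using t[OF Q] by blast
    then show ?thesis using Q by blast
  qed
qed

text \<open>The relation \<open>code\<close> need not be functional: choosing for each code one element that has it
  meets every class. This form suits codes that are themselves chosen only up to isomorphism.\<close>

lemma finite_up_to_coding:
  assumes sym: "\<And>x y. x \<in> C \<Longrightarrow> y \<in> C \<Longrightarrow> r x y \<Longrightarrow> r y x"
    and trans: "\<And>x y z. x \<in> C \<Longrightarrow> y \<in> C \<Longrightarrow> z \<in> C \<Longrightarrow> r x y \<Longrightarrow> r y z \<Longrightarrow> r x z"
    and L: "finite L" "\<And>x. x \<in> C \<Longrightarrow> \<exists>l\<in>L. code x l"
    and code: "\<And>x y l. x \<in> C \<Longrightarrow> y \<in> C \<Longrightarrow> l \<in> L \<Longrightarrow> code x l \<Longrightarrow> code y l \<Longrightarrow> r x y"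
  shows "finite_up_to r C"
proof -
  let ?r = "{(x, y). x \<in> C \<and> y \<in> C \<and> r x y}"
  let ?t = "\<lambda>l. SOME x. x \<in> C \<and> code x l"
  have "C // ?r \<subseteq> (\<lambda>l. ?r `` {?t l}) ` L"
  proof
    fix Q assume "Q \<in> C // ?r"
    then obtain x where x: "x \<in> C" "Q = ?r `` {x}" by (auto elim: quotientE)
    obtain l where l: "l \<in> L" "code x l" using L x by blast
    have t: "?t l \<in> C \<and> code (?t l) l" by (rule someI[of _ x]) (use x l in blast)
    then have "r x (?t l)" "r (?t l) x" using code x l by blast+
    then have "?r `` {x} = ?r `` {?t l}" using trans t x by blast
    then show "Q \<in> (\<lambda>l. ?r `` {?t l}) ` L" using x l by blast
  qed
  then show ?thesis using L(1) by (auto simp: finite_up_to_def intro: finite_subset)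
qed

context left_module
begin

section \<open>Partial sums of a decomposition\<close>

lemma internal_sum_subset:
  assumes AW: "internal_sum R M A N W" and B: "B \<subseteq> A"
  obtains K L where "internal_sum R M B N K" "internal_sum R M (A - B) N L" "binary_sum R M K L W"
  by (rule internal_sum_Un_split[of B "A - B" N W]) (use assms in \<open>auto simp: Un_absorb1\<close>)

lemma internal_sum_component:
  assumes A: "internal_sum R M A N W" and \<alpha>: "\<alpha> \<in> A"
  obtains L where "binary_sum R M (N \<alpha>) L W"
proof -
  have "{\<alpha>} \<subseteq> A" using \<alpha> by simp
  then obtain K L where KL: "internal_sum R M {\<alpha>} N K" "binary_sum R M K L W"
    using internal_sum_subset[OF A] by blast
  have "internal_sum R M {\<alpha>} N (N \<alpha>)"
    by (rule internal_sum_single) (use A \<alpha> in \<open>auto simp: internal_sum_def\<close>)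
  then show ?thesis using KL internal_sum_unique that by blast
qed

text \<open>For families indexed by their own members, independence of the two sums forces disjoint index
  sets, so that their union again decomposes the sum.\<close>

lemma internal_sum_disjoint:
  assumes A: "internal_sum R M A (\<lambda>U. U) K" and B: "internal_sum R M B (\<lambda>U. U) L"
    and KL: "binary_sum R M K L W"
  shows "A \<inter> B = {}"
proof (rule ccontr)
  assume "A \<inter> B \<noteq> {}"
  then obtain U where U: "U \<in> A" "U \<in> B" by blast
  have "U \<subseteq> K" using internal_sum_component[OF A U(1)] binary_sum_subset by metis
  moreover have "U \<subseteq> L" using internal_sum_component[OF B U(2)] binary_sum_subset by metis
  moreover have "\<zero>\<^bsub>M\<^esub> \<in> U" "U \<noteq> {\<zero>\<^bsub>M\<^esub>}"
    using A U(1) by (auto simp: internal_sum_def submodule_iff)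
  moreover have "K \<inter> L = {\<zero>\<^bsub>M\<^esub>}" using KL by (simp add: binary_sum_def)
  ultimately show False by blast
qed

lemma internal_sum_psubset:
  assumes A: "internal_sum R M A N W" and B: "internal_sum R M B N K" and BA: "B \<subset> A"
  shows "K \<subset> W"
proof -
  obtain K' L where KL: "internal_sum R M B N K'" "internal_sum R M (A - B) N L" "binary_sum R M K' L W"
    using internal_sum_subset[OF A] BA by blast
  obtain \<alpha> where \<alpha>: "\<alpha> \<in> A - B" using BA by blast
  then obtain L' where "binary_sum R M (N \<alpha>) L' L" using internal_sum_component[OF KL(2)] by blast
  then have "N \<alpha> \<subseteq> L" by (rule binary_sum_subset)
  moreover have "\<zero>\<^bsub>M\<^esub> \<in> N \<alpha>" "N \<alpha> \<noteq> {\<zero>\<^bsub>M\<^esub>}"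
    using KL(2) \<alpha> by (auto simp: internal_sum_def submodule_iff)
  ultimately have "L \<noteq> {\<zero>\<^bsub>M\<^esub>}" by blast
  then have "K' \<subset> W" using KL(3) by (rule binary_sum_psubset[rotated])
  then show ?thesis using internal_sum_unique[OF B KL(1)] by simp
qed

text \<open>Peeling off one component at a time reduces this to two summands.\<close>

lemma internal_sum_isomorphic:
  assumes "finite A" "inj_on \<phi> A" "\<And>\<alpha>. \<alpha> \<in> A \<Longrightarrow> submodule_isomorphic R M (N \<alpha>) (P (\<phi> \<alpha>))"
    "internal_sum R M A N K" "internal_sum R M (\<phi> ` A) P L"
  shows "submodule_isomorphic R M K L"
  using assms
proof (induction A arbitrary: K L)
  case empty
  then show ?case by (simp add: internal_sum_empty_iff module_isomorphic_refl)
next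
  case (insert \<alpha> A)
  have ins: "insert \<alpha> A = {\<alpha>} \<union> A" "\<phi> ` insert \<alpha> A = {\<phi> \<alpha>} \<union> \<phi> ` A"
    and disj: "{\<alpha>} \<inter> A = {}" "{\<phi> \<alpha>} \<inter> \<phi> ` A = {}"
    using insert by auto
  obtain K1 K2 where K: "internal_sum R M {\<alpha>} N K1" "internal_sum R M A N K2" "binary_sum R M K1 K2 K"
    using internal_sum_Un_split[OF insert.prems(3)[unfolded ins(1)] disj(1)] .
  obtain L1 L2 where L: "internal_sum R M {\<phi> \<alpha>} P L1" "internal_sum R M (\<phi> ` A) P L2"
    "binary_sum R M L1 L2 L"
    using internal_sum_Un_split[OF insert.prems(4)[unfolded ins(2)] disj(2)] .
  have "K1 = N \<alpha>"
    by (intro internal_sum_unique[OF K(1)] internal_sum_single)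
      (use K(1) in \<open>auto simp: internal_sum_def\<close>)
  moreover have "L1 = P (\<phi> \<alpha>)"
    by (intro internal_sum_unique[OF L(1)] internal_sum_single)
      (use L(1) in \<open>auto simp: internal_sum_def\<close>)
  ultimately have "submodule_isomorphic R M K1 L1" using insert.prems by simp
  moreover have "submodule_isomorphic R M K2 L2"
    by (rule insert.IH) (use insert.prems K L in auto)
  ultimately show ?case using binary_sum_isomorphic[OF K(3) L(3)] by blast
qed

text \<open>\<open>S i\<close> is the sum of the components that remain after \<open>e 0, \<dots>, e (i - 1)\<close> are removed. The
  strictness statement only looks at \<open>e\<close> below \<open>j\<close>, so that \<open>e\<close> may be an injection of all natural
  numbers into an infinite index set or an enumeration of a finite one.\<close>

lemma internal_sum_partial_sums_chain:
  fixes e :: "nat \<Rightarrow> 'i"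
  assumes A: "internal_sum R M A N (carrier M)"
  obtains S where "\<And>i. S i \<in> direct_summands R M"
    "\<And>i j. i < j \<Longrightarrow> inj_on e {..<j} \<Longrightarrow> e ` {..<j} \<subseteq> A \<Longrightarrow> S j \<subset> S i"
proof -
  have "\<exists>K. internal_sum R M (A - e ` {..<i}) N K \<and> K \<in> direct_summands R M" for i
    by (rule internal_sum_subset[OF A, of "A - e ` {..<i}"]) (auto simp: direct_summands_iff)
  then obtain S where S: "internal_sum R M (A - e ` {..<i}) N (S i)" "S i \<in> direct_summands R M" for i
    by metis
  have "S j \<subset> S i" if "i < j" "inj_on e {..<j}" "e ` {..<j} \<subseteq> A" for i j
  proof (rule internal_sum_psubset[OF S(1) S(1)])
    have "e i \<in> A" "e i \<in> e ` {..<j}" using that by auto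
    moreover have "e i \<notin> e ` {..<i}" using that by (force dest: inj_onD)
    moreover have "e ` {..<i} \<subseteq> e ` {..<j}" using that(1) by auto
    ultimately show "A - e ` {..<j} \<subset> A - e ` {..<i}" by blast
  qed
  with S that show ?thesis by blast
qed

section \<open>Consequences of the chain condition\<close>

lemma krull_schmidt_artinian_finite_index:
  assumes ksa: "krull_schmidt_artinian R M" and A: "internal_sum R M A N (carrier M)"
  shows "finite A"
proof (rule ccontr)
  assume "infinite A"
  then obtain e :: "nat \<Rightarrow> _" where e: "inj e" "range e \<subseteq> A"
    using infinite_countable_subset by blast
  obtain S where S: "\<And>i. S i \<in> direct_summands R M"
    "\<And>i j. i < j \<Longrightarrow> inj_on e {..<j} \<Longrightarrow> e ` {..<j} \<subseteq> A \<Longrightarrow> S j \<subset> S i"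
    using internal_sum_partial_sums_chain[OF A] by blast
  have "S (Suc n) \<subset> S n" for n
    by (rule S(2)) (use e in \<open>auto intro: inj_on_subset\<close>)
  then show False using S(1) ksa unfolding krull_schmidt_artinian_def by blast
qed

text \<open>A nonzero decomposable summand is the sum of two strictly smaller summands of \<open>M\<close>; the chain
  condition makes the strict inclusion of summands well-founded, and the decompositions of the two
  parts are united.\<close>

lemma indecomposable_decomposition_exists:
  assumes ksa: "krull_schmidt_artinian R M" and K: "K \<in> direct_summands R M"
  shows "\<exists>A. internal_sum R M A (\<lambda>U. U) K \<and> (\<forall>U\<in>A. indecomposable R (M\<lparr>carrier := U\<rparr>))"
proof -
  have "wf {(K', K). K' \<in> direct_summands R M \<and> K \<in> direct_summands R M \<and> K' \<subset> K}"
    unfolding wf_iff_no_infinite_down_chain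
    using ksa unfolding krull_schmidt_artinian_def by blast
  then show ?thesis
    using K
  proof (induction K rule: wf_induct_rule)
    case (less K)
    have sK: "submodule K R M" using less.prems by (rule summand_submodule)
    consider "K = {\<zero>\<^bsub>M\<^esub>}" | "K \<noteq> {\<zero>\<^bsub>M\<^esub>}" "indecomposable R (M\<lparr>carrier := K\<rparr>)"
      | U V where "binary_sum R M U V K" "U \<noteq> {\<zero>\<^bsub>M\<^esub>}" "V \<noteq> {\<zero>\<^bsub>M\<^esub>}"
      using complementary_submodule_iff[OF sK] by (auto simp: indecomposable_def)
    then show ?case
    proof cases
      case 1
      then have "internal_sum R M {} (\<lambda>U. U) K" using internal_sum_empty_iff by blast
      then show ?thesis by blast
    next
      case 2
      then have "internal_sum R M {K} (\<lambda>U. U) K" using internal_sum_single[of "\<lambda>U. U" K] sK by blast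
      then show ?thesis using 2 by blast
    next
      case (3 U V)
      note VU = binary_sum_commute[OF 3(1)]
      have DS: "U \<in> direct_summands R M" "V \<in> direct_summands R M"
        using summand_trans 3(1) VU less.prems by blast+
      have "U \<subset> K" "V \<subset> K" using binary_sum_psubset 3 VU by blast+
      then obtain A B where A: "internal_sum R M A (\<lambda>U. U) U" "\<forall>U\<in>A. indecomposable R (M\<lparr>carrier := U\<rparr>)"
        and B: "internal_sum R M B (\<lambda>U. U) V" "\<forall>U\<in>B. indecomposable R (M\<lparr>carrier := U\<rparr>)"
        using less.IH[of U] less.IH[of V] DS less.prems by blast
      have "A \<inter> B = {}" using internal_sum_disjoint[OF A(1) B(1) 3(1)] .
      then show ?thesis using internal_sum_Un[OF A(1) B(1) _ 3(1)] A(2) B(2) by blast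
    qed
  qed
qed

text \<open>If \<open>f\<close> maps \<open>K\<close> isomorphically onto a summand \<open>K' \<subset> K\<close>, then \<open>f\<close> maps each summand of \<open>M\<close>
  inside \<open>K\<close> to a summand of \<open>K'\<close>, hence of \<open>M\<close>, and \<open>K \<supset> f K \<supset> f (f K) \<supset> \<dots>\<close> contradicts the chain
  condition.\<close>

lemma summand_not_isomorphic_psubset:
  assumes ksa: "krull_schmidt_artinian R M"
    and K: "K \<in> direct_summands R M" and K': "K' \<in> direct_summands R M" "K' \<subset> K"
  shows "\<not> submodule_isomorphic R M K K'"
proof
  assume "submodule_isomorphic R M K K'"
  then obtain f where f: "linear_iso R M f K K'" using submodule_isomorphic_iff_linear_iso by blast
  then have b: "inj_on f K" "f ` K = K'" by (auto simp: linear_iso_def bij_betw_def)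
  have sm: "submodule K R M" "submodule K' R M" using K K' summand_submodule by blast+
  have img: "f ` U \<in> direct_summands R M" if U: "U \<in> direct_summands R M" "U \<subseteq> K" for U
  proof -
    obtain Y where Y: "binary_sum R M U Y (carrier M)" using U direct_summands_iff by blast
    have "binary_sum R M U (K \<inter> Y) K"
      by (rule binary_sum_modular[OF Y]) (use sm U in \<open>auto simp: submodule_iff\<close>)
    then have "binary_sum R M (f ` U) (f ` (K \<inter> Y)) K'"
      by (rule linear_iso_image_binary_sum[OF f sm(2)])
    then show ?thesis using K'(1) by (rule summand_trans)
  qed
  define S where "S n = ((`) f ^^ n) K" for n
  have S: "S n \<in> direct_summands R M \<and> S n \<subseteq> K \<and> S (Suc n) \<subset> S n" for n
  proof (induction n)
    case 0
    then show ?case using K K' b by (simp add: S_def)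
  next
    case (Suc n)
    have "S (Suc n) \<subseteq> K" using Suc by blast
    moreover have "S (Suc n) = f ` S n" "S (Suc (Suc n)) = f ` S (Suc n)" by (simp_all add: S_def)
    moreover have "f ` S (Suc n) \<subset> f ` S n"
      using Suc b(1) by (meson image_strict_mono inj_on_subset)
    ultimately show ?case using img Suc by simp
  qed
  then show False using ksa unfolding krull_schmidt_artinian_def by blast
qed

text \<open>A decomposition with \<open>k\<close> components has a chain of \<open>k + 1\<close> partial sums \<open>S 0 \<supset> \<dots> \<supset> S k\<close>. If \<open>T\<close> had at
  most \<open>k\<close> elements, two of them would share a representative and so be isomorphic.\<close>

lemma card_index_bounded:
  assumes ksa: "krull_schmidt_artinian R M" and A: "internal_sum R M A N (carrier M)"
    and T: "finite T" "T \<subseteq> direct_summands R M"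
      "\<And>K. K \<in> direct_summands R M \<Longrightarrow> \<exists>t\<in>T. submodule_isomorphic R M t K"
  shows "card A < card T"
proof (rule ccontr)
  assume "\<not> card A < card T"
  have "finite A" using ksa A by (rule krull_schmidt_artinian_finite_index)
  then obtain e where e: "bij_betw e {..<card A} A"
    using ex_bij_betw_nat_finite[of A] by (auto simp: atLeast0LessThan)
  obtain S where S: "\<And>i. S i \<in> direct_summands R M"
    "\<And>i j. i < j \<Longrightarrow> inj_on e {..<j} \<Longrightarrow> e ` {..<j} \<subseteq> A \<Longrightarrow> S j \<subset> S i"
    using internal_sum_partial_sums_chain[OF A] by blast
  obtain c where c: "\<And>i. c i \<in> T" "\<And>i. submodule_isomorphic R M (c i) (S i)"
    using T(3)[OF S(1)] by metis
  have "card (c ` {..card A}) \<le> card T" using c T by (intro card_mono) auto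
  then have "\<not> inj_on c {..card A}"
    using \<open>\<not> card A < card T\<close> by (intro pigeonhole) simp
  then obtain i j where ij: "i < j" "j \<le> card A" "c i = c j"
    unfolding inj_on_def by (metis atMost_iff linorder_neqE_nat)
  have "submodule_isomorphic R M (S i) (c i)"
    using c T(2) summand_submodule by (blast intro: submodule_isomorphic_sym)
  then have "submodule_isomorphic R M (S i) (S j)"
    using submodule_isomorphic_trans c(2)[of j] ij(3) by metis
  moreover have "inj_on e {..<j}" "e ` {..<j} \<subseteq> A"
    using e ij(2) by (auto simp: bij_betw_def intro: inj_on_subset)
  then have "S j \<subset> S i" using S(2) ij(1) by blast
  ultimately show False using summand_not_isomorphic_psubset[OF ksa S(1) S(1)] by blast
qed

section \<open>The three finiteness conditions\<close>

lemma decomposition_isomorphic_refl: "decomposition_isomorphic R M A N A N"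
  unfolding decomposition_isomorphic_def
  by (rule exI[of _ id]) (simp add: module_isomorphic_refl)

lemma decomposition_isomorphic_sym:
  assumes iso: "decomposition_isomorphic R M A N B P" and A: "direct_sum_decomposition R M A N"
  shows "decomposition_isomorphic R M B P A N"
proof -
  obtain \<phi> where \<phi>: "bij_betw \<phi> A B" "\<And>\<alpha>. \<alpha> \<in> A \<Longrightarrow> submodule_isomorphic R M (N \<alpha>) (P (\<phi> \<alpha>))"
    using iso by (auto simp: decomposition_isomorphic_def)
  have "submodule_isomorphic R M (P \<beta>) (N (inv_into A \<phi> \<beta>))" if "\<beta> \<in> B" for \<beta>
  proof -
    have "inv_into A \<phi> \<beta> \<in> A" "\<phi> (inv_into A \<phi> \<beta>) = \<beta>"
      using \<phi>(1) that by (auto simp: bij_betw_def inv_into_into f_inv_into_f)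
    then show ?thesis
      using \<phi>(2)[of "inv_into A \<phi> \<beta>"] A
      by (auto simp: direct_sum_decomposition_def intro!: submodule_isomorphic_sym)
  qed
  then show ?thesis
    using bij_betw_inv_into[OF \<phi>(1)] unfolding decomposition_isomorphic_def by blast
qed

lemma decomposition_isomorphic_trans:
  assumes "decomposition_isomorphic R M A N B P" "decomposition_isomorphic R M B P C Q"
  shows "decomposition_isomorphic R M A N C Q"
proof -
  obtain \<phi> \<psi> where *: "bij_betw \<phi> A B" "\<And>\<alpha>. \<alpha> \<in> A \<Longrightarrow> submodule_isomorphic R M (N \<alpha>) (P (\<phi> \<alpha>))"
    "bij_betw \<psi> B C" "\<And>\<alpha>. \<alpha> \<in> B \<Longrightarrow> submodule_isomorphic R M (P \<alpha>) (Q (\<psi> \<alpha>))"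
    using assms unfolding decomposition_isomorphic_def by blast
  have "submodule_isomorphic R M (N \<alpha>) (Q ((\<psi> \<circ> \<phi>) \<alpha>))" if "\<alpha> \<in> A" for \<alpha>
    using submodule_isomorphic_trans[OF *(2)[OF that] *(4)] *(1) that by (simp add: bij_betwE)
  then show ?thesis
    using bij_betw_trans[OF *(1,3)] unfolding decomposition_isomorphic_def by blast
qed

definition decomposition_equiv ::
    "'b set set \<times> ('b set \<Rightarrow> 'b set) \<Rightarrow> 'b set set \<times> ('b set \<Rightarrow> 'b set) \<Rightarrow> bool" where
  "decomposition_equiv x y \<longleftrightarrow> decomposition_isomorphic R M (fst x) (snd x) (fst y) (snd y)"

lemma AKS1_iff: "AKS1 R M \<longleftrightarrow> finite_up_to decomposition_equiv (decompositions R M)"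
  and AKS2_iff: "AKS2 R M \<longleftrightarrow> finite_up_to decomposition_equiv (indecomposable_decompositions R M)"
proof -
  have "(\<lambda>(A, N) (B, P). decomposition_isomorphic R M A N B P) = decomposition_equiv"
    by (auto simp: decomposition_equiv_def fun_eq_iff)
  then show "AKS1 R M \<longleftrightarrow> finite_up_to decomposition_equiv (decompositions R M)"
    and "AKS2 R M \<longleftrightarrow> finite_up_to decomposition_equiv (indecomposable_decompositions R M)"
    by (simp_all add: AKS1_def AKS2_def)
qed

lemma decomposition_equiv_refl: "decomposition_equiv x x"
  by (simp add: decomposition_equiv_def decomposition_isomorphic_refl)

lemma decomposition_equiv_sym:
  "x \<in> decompositions R M \<Longrightarrow> decomposition_equiv x y \<Longrightarrow> decomposition_equiv y x"
  by (auto simp: decomposition_equiv_def decompositions_def intro: decomposition_isomorphic_sym)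

lemma decomposition_equiv_trans:
  "decomposition_equiv x y \<Longrightarrow> decomposition_equiv y z \<Longrightarrow> decomposition_equiv x z"
  unfolding decomposition_equiv_def by (rule decomposition_isomorphic_trans)

lemma AKS1_imp_AKS2:
  assumes "AKS1 R M"
  shows "AKS2 R M"
proof -
  have sub: "indecomposable_decompositions R M \<subseteq> decompositions R M"
    by (auto simp: indecomposable_decompositions_def decompositions_def indecomposable_decomposition_def)
  obtain T where T: "finite T" "T \<subseteq> decompositions R M"
      "\<And>x. x \<in> decompositions R M \<Longrightarrow> \<exists>t\<in>T. decomposition_equiv t x"
    using finite_up_to_representatives[OF assms[unfolded AKS1_iff] decomposition_equiv_refl] by blast
  show ?thesis
    unfolding AKS2_iff
  proof (rule finite_up_to_coding[OF _ _ T(1), where code = "\<lambda>x t. decomposition_equiv t x"])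
    fix x y t assume t: "t \<in> T" "decomposition_equiv t x" "decomposition_equiv t y"
    then have "decomposition_equiv x t" using T(2) decomposition_equiv_sym by blast
    then show "decomposition_equiv x y" using t(3) by (rule decomposition_equiv_trans)
  qed (use T(3) sub decomposition_equiv_sym decomposition_equiv_trans in blast)+
qed

text \<open>A summand is coded by a representative \<open>t\<close> of the indecomposable decompositions together with
  the set of those components of \<open>t\<close> whose sum is isomorphic to the summand.\<close>

lemma AKS2_imp_AKS3:
  assumes ksa: "krull_schmidt_artinian R M" and aks: "AKS2 R M"
  shows "AKS3 R M"
proof -
  let ?D = "indecomposable_decompositions R M"
  obtain T where T: "finite T" "T \<subseteq> ?D" "\<And>x. x \<in> ?D \<Longrightarrow> \<exists>t\<in>T. decomposition_equiv t x"
    using finite_up_to_representatives[OF aks[unfolded AKS2_iff] decomposition_equiv_refl] by blast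
  have D: "internal_sum R M A N (carrier M)" if "(A, N) \<in> ?D" for A N
    using that by (simp add: indecomposable_decompositions_def indecomposable_decomposition_def
        direct_sum_decomposition_iff_internal_sum)
  let ?L = "SIGMA t:T. Pow (fst t)"
  let ?code = "\<lambda>K l. \<exists>L. internal_sum R M (snd l) (snd (fst l)) L \<and> submodule_isomorphic R M K L"
  have "finite (fst t)" if "t \<in> T" for t
    using that T(2) D[of "fst t" "snd t"] krull_schmidt_artinian_finite_index[OF ksa] by auto
  then have L: "finite ?L" using T(1) by (intro finite_SigmaI) auto
  show ?thesis
    unfolding AKS3_def
  proof (rule finite_up_to_coding[OF _ _ L, where code = ?code])
    fix K assume K: "K \<in> direct_summands R M"
    then obtain K' where KK: "binary_sum R M K K' (carrier M)" using direct_summands_iff by blast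
    have "K' \<in> direct_summands R M" using binary_sum_commute[OF KK] direct_summands_iff by blast
    then obtain A A' where A: "internal_sum R M A (\<lambda>U. U) K" "\<forall>U\<in>A. indecomposable R (M\<lparr>carrier := U\<rparr>)"
      and A': "internal_sum R M A' (\<lambda>U. U) K'" "\<forall>U\<in>A'. indecomposable R (M\<lparr>carrier := U\<rparr>)"
      using indecomposable_decomposition_exists[OF ksa] K by metis
    have "A \<inter> A' = {}" using internal_sum_disjoint[OF A(1) A'(1) KK] .
    then have sum: "internal_sum R M (A \<union> A') (\<lambda>U. U) (carrier M)"
      using internal_sum_Un[OF A(1) A'(1) _ KK] by blast
    then have "(A \<union> A', \<lambda>U. U) \<in> ?D"
      using A(2) A'(2) by (auto simp: indecomposable_decompositions_def
          indecomposable_decomposition_def direct_sum_decomposition_iff_internal_sum)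
    then obtain B N where BN: "(B, N) \<in> T" "decomposition_isomorphic R M B N (A \<union> A') (\<lambda>U. U)"
      using T(3) unfolding decomposition_equiv_def by fastforce
    have B: "internal_sum R M B N (carrier M)" using D BN(1) T(2) by blast
    obtain \<phi> where \<phi>: "bij_betw \<phi> (A \<union> A') B"
        "\<And>U. U \<in> A \<union> A' \<Longrightarrow> submodule_isomorphic R M U (N (\<phi> U))"
      using decomposition_isomorphic_sym[OF BN(2)] B
      by (auto simp: decomposition_isomorphic_def direct_sum_decomposition_iff_internal_sum)
    then have sub: "\<phi> ` A \<subseteq> B" and inj: "inj_on \<phi> A" by (auto simp: bij_betw_def inj_on_Un)
    obtain L where "internal_sum R M (\<phi> ` A) N L" using internal_sum_subset[OF B sub] by blast
    moreover have "finite A" using krull_schmidt_artinian_finite_index[OF ksa sum] by simp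
    ultimately have "?code K ((B, N), \<phi> ` A)"
      using internal_sum_isomorphic[of A \<phi> "\<lambda>U. U" N K L] inj \<phi>(2) A(1) by auto
    then show "\<exists>l\<in>?L. ?code K l" using BN(1) sub by (intro bexI[of _ "((B, N), \<phi> ` A)"]) auto
  next
    fix K K' l assume K: "K \<in> direct_summands R M" "K' \<in> direct_summands R M"
      and "l \<in> ?L" "?code K l" "?code K' l"
    then obtain L where "submodule_isomorphic R M K L" "submodule_isomorphic R M K' L"
      using internal_sum_unique by metis
    then have "submodule_isomorphic R M K L" "submodule_isomorphic R M L K'"
      using submodule_isomorphic_sym[OF _ summand_submodule[OF K(2)]] by blast+
    then show "submodule_isomorphic R M K K'" by (rule submodule_isomorphic_trans)
  qed (blast intro: submodule_isomorphic_sym submodule_isomorphic_trans summand_submodule)+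
qed

text \<open>A decomposition is coded by a list of representatives of its components, taken in any order.
  Two decompositions with the same code are matched position by position.\<close>

lemma AKS3_imp_AKS1:
  assumes ksa: "krull_schmidt_artinian R M" and aks: "AKS3 R M"
  shows "AKS1 R M"
proof -
  obtain T where T: "finite T" "T \<subseteq> direct_summands R M"
      "\<And>K. K \<in> direct_summands R M \<Longrightarrow> \<exists>t\<in>T. submodule_isomorphic R M t K"
    using finite_up_to_representatives[OF aks[unfolded AKS3_def] module_isomorphic_refl] by blast
  let ?L = "{l. set l \<subseteq> T \<and> length l \<le> card T}"
  let ?code = "\<lambda>(A, N) l. \<exists>as. distinct as \<and> set as = A \<and>
    list_all2 (\<lambda>\<alpha> t. submodule_isomorphic R M (N \<alpha>) t) as l"
  have L: "finite ?L" using T(1) by (rule finite_lists_length_le)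
  show ?thesis
    unfolding AKS1_iff
  proof (rule finite_up_to_coding[OF _ _ L, where code = ?code])
    fix x assume "x \<in> decompositions R M"
    then obtain A N where x: "x = (A, N)" and A: "internal_sum R M A N (carrier M)"
      by (auto simp: decompositions_def direct_sum_decomposition_iff_internal_sum)
    have "\<exists>t\<in>T. submodule_isomorphic R M (N \<alpha>) t" if \<alpha>: "\<alpha> \<in> A" for \<alpha>
    proof -
      have "N \<alpha> \<in> direct_summands R M"
        using internal_sum_component[OF A \<alpha>] direct_summands_iff by blast
      then show ?thesis using T(2,3) by (blast intro: submodule_isomorphic_sym summand_submodule)
    qed
    then obtain c where c: "\<And>\<alpha>. \<alpha> \<in> A \<Longrightarrow> c \<alpha> \<in> T \<and> submodule_isomorphic R M (N \<alpha>) (c \<alpha>)" by metis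
    obtain as where as: "distinct as" "set as = A"
      using finite_distinct_list krull_schmidt_artinian_finite_index[OF ksa A] by blast
    have "length as < card T"
      using card_index_bounded[OF ksa A T] distinct_card[OF as(1)] as(2) by simp
    then have "map c as \<in> ?L" using as c by auto
    moreover have "?code x (map c as)"
      using as c x by (auto simp: list_all2_conv_all_nth)
    ultimately show "\<exists>l\<in>?L. ?code x l" by blast
  next
    fix x y l assume "x \<in> decompositions R M" "y \<in> decompositions R M" "?code x l" "?code y l"
    then obtain A N B P as bs where xy: "x = (A, N)" "y = (B, P)"
      and B: "direct_sum_decomposition R M B P"
      and as: "distinct as" "set as = A" "list_all2 (\<lambda>\<alpha> t. submodule_isomorphic R M (N \<alpha>) t) as l"
      and bs: "distinct bs" "set bs = B" "list_all2 (\<lambda>\<alpha> t. submodule_isomorphic R M (P \<alpha>) t) bs l"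
      by (auto simp: decompositions_def)
    have len: "length as = length bs" using as(3) bs(3) by (metis list_all2_lengthD)
    have bij: "bij_betw ((!) as) {..<length bs} A" "bij_betw ((!) bs) {..<length bs} B"
      using as bs len by (auto intro: bij_betw_nth)
    let ?i = "inv_into {..<length bs} ((!) as)"
    have "submodule_isomorphic R M (N \<alpha>) (P (((!) bs \<circ> ?i) \<alpha>))" if \<alpha>: "\<alpha> \<in> A" for \<alpha>
    proof -
      have i: "?i \<alpha> < length bs" "as ! ?i \<alpha> = \<alpha>"
        using bij(1) \<alpha> inv_into_into[of \<alpha> "(!) as" "{..<length bs}"]
        by (auto simp: bij_betw_def f_inv_into_f)
      have "bs ! ?i \<alpha> \<in> B" using i bs(2) by auto
      then have "submodule (P (bs ! ?i \<alpha>)) R M" using B by (auto simp: direct_sum_decomposition_def)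
      moreover have "submodule_isomorphic R M (P (bs ! ?i \<alpha>)) (l ! ?i \<alpha>)"
        using bs(3) i by (auto simp: list_all2_conv_all_nth)
      ultimately have "submodule_isomorphic R M (l ! ?i \<alpha>) (P (bs ! ?i \<alpha>))"
        by (rule submodule_isomorphic_sym[rotated])
      moreover have "submodule_isomorphic R M (N \<alpha>) (l ! ?i \<alpha>)"
        using as(3) i len by (metis list_all2_nthD)
      ultimately show ?thesis using submodule_isomorphic_trans by simp
    qed
    then show "decomposition_equiv x y"
      unfolding xy decomposition_equiv_def decomposition_isomorphic_def
      using bij_betw_trans[OF bij_betw_inv_into[OF bij(1)] bij(2)] by auto
  qed (blast intro: decomposition_equiv_sym decomposition_equiv_trans)+
qed

end

theorem proposition6p3:
  fixes R :: "('a, 'r) ring_scheme" and M :: "('a, 'b, 'm) module_scheme"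
  assumes "left_module R M"
    and "krull_schmidt_artinian R M"
  shows "(AKS1 R M \<longleftrightarrow> AKS2 R M) \<and> (AKS2 R M \<longleftrightarrow> AKS3 R M)"
  using left_module.AKS1_imp_AKS2 left_module.AKS2_imp_AKS3 left_module.AKS3_imp_AKS1 assms by blast

end
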